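(* Let $r\ge1$, $\delta\ge3$, $\Delta$ and $m\ge1$ be integers with $\delta\ge\Delta$, and let $n_L=r+\delta-1$. Let $\mathcal{C}_0$ be an $((n_L+\Delta,r,d),(\alpha,\beta))$ MSR code over $\mathbb{F}_q$ with $d\le r+\delta-2$, having generator matrix $G_0=[G_L\mid Q_\Delta]$, where $G_L$ is of size $r\alpha\times n_L\alpha$ and $Q_\Delta$ of size $r\alpha\times\Delta\alpha$. Let $\mathcal{C}$ be the vector code with vector-size parameter $\alpha$ and generator matrix $$G=\left[\begin{array}{ccc|c}G_L&&&Q_\Delta\\&\ddots&&\vdots\\&&G_L&Q_\Delta\end{array}\right],$$ in which both $G_L$ and $Q_\Delta$ appear $m$ times (off-diagonal blocks being zero). Then $\mathcal{C}$ is an MSR-local code with $(r,\delta)$ information locality, and has (a) length $n=mn_L+\Delta$ and vector-size parameter $\alpha$; (b) $m$ support-disjoint local codes, each of which is MSR with parameters $((n_L,r,d),(\alpha,\beta))$ and possesses generator matrix $G_L$; (c) scalar dimension $K=mr\alpha$; and (d) minimum distance $$d_{\min}=n-\frac{K}{\alpha}+1-\left(\frac{K}{r\alpha}-1\right)(\delta-1)=\delta+\Delta .$$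
   Context: Vector codes. An $\mathbb{F}_q$-linear vector code $\mathcal{C}$ of block length $n$ with vector-size parameter $\alpha$ is an $\mathbb{F}_q$-linear subspace of $(\mathbb{F}_q^\alpha)^n$; its scalar dimension is $K=\dim_{\mathbb{F}_q}\mathcal{C}$. Its generator matrix $G$ is a $K\times n\alpha$ generator matrix of the scalar code obtained by expanding each vector symbol; columns $(i-1)\alpha+1,\dots,i\alpha$ form the $i$-th thick column, associated with the $i$-th vector symbol. Standing assumption: the $\alpha$ columns in each thick column are linearly independent. For $S\subseteq[n]$, $G|_S$ is the restriction to thick columns in $S$, and $\mathcal{C}|_S$ the punctured code (restriction of codewords to $S$). $d_{\min}$ is the minimum Hamming weight, counted in vector symbols, of a nonzero codeword. MSR codes. A linear (exact-repair) $((n,k,d),(\alpha,\beta),B)$ regenerating code over $\mathbb{F}_q$ ($k\le d\le n-1$) is a vector code of block length $n$ (the vector symbols being the node contents), vector-size parameter $\alpha$ and scalar dimension $B$ such that (i) every codeword is determined by any $k$ of its vector symbols; (ii) for every node $i\in[n]$ and every set $D\subseteq[n]\setminus\{i\}$ with $|D|=d$ there are $\mathbb{F}_q$-linear maps $\varphi_h:\mathbb{F}_q^\alpha\to\mathbb{F}_q^\beta$, $h\in D$, such that for every codeword $\mathbf{c}$ the symbol $\mathbf{c}_i$ is determined by $(\varphi_h(\mathbf{c}_h))_{h\in D}$. It is an MSR code if $B=k\alpha$ and $\alpha=(d-k+1)\beta$. An MSR code with parameters $(n,k,d)$ is called an $(n,k,d)$-MSR code. Locality. $\mathcal{C}$ has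 $(r,\delta)$ information locality if there are sets $S_i\subseteq[n]$, $i\in\mathcal{L}$, with $|S_i|\le r+\delta-1$, $d_{\min}(\mathcal{C}|_{S_i})\ge\delta$, and $\mathrm{Rank}(G|_{\cup_iS_i})=K$; the $\mathcal{C}|_{S_i}$ are the local codes. $\mathcal{C}$ (with $(r,\delta)$ information locality) is an MSR-local code with $(r,\delta)$ information locality if it can be punctured to yield local codes $\mathcal{C}_i=\mathcal{C}|_{S_i}$, $i=1,\dots,m$, each an $(n_L,r,d)$-MSR code with $n_L=r+\delta-1$, such that $\mathrm{Rank}(G|_{\cup_{i=1}^mS_i})=K$. *)

theory Defs
  imports "Jordan_Normal_Form.DL_Rank"
begin

text \<open>
  The ambient space \<open>(\<F>\<^sub>q\<^sup>\<alpha>)\<^sup>n\<close> is represented in expanded form as \<open>carrier_vec (n * \<alpha>)\<close>.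
  Vector symbols (nodes) and thick columns are numbered from 0, so the symbol \<open>i < n\<close>
  occupies the scalar coordinates \<open>i * \<alpha>, \<dots>, i * \<alpha> + \<alpha> - 1\<close>.
\<close>

definition symbol :: "nat \<Rightarrow> 'a vec \<Rightarrow> nat \<Rightarrow> 'a vec" where
  "symbol \<alpha> c i = vec \<alpha> (\<lambda>t. c $ (i * \<alpha> + t))"

definition scalar_dim :: "nat \<Rightarrow> 'a::field vec set \<Rightarrow> nat" where
  "scalar_dim N C = vectorspace.dim class_ring ((module_vec TYPE('a) N)\<lparr>carrier := C\<rparr>)"

text \<open>
  The row count is forced to be the dimension of the code, so the rows of a generator matrix
  form a basis of the code.
\<close>

definition generator_matrix :: "nat \<Rightarrow> nat \<Rightarrow> 'a::field vec set \<Rightarrow> 'a mat \<Rightarrow> bool" where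
  "generator_matrix \<alpha> n C G \<longleftrightarrow>
     G \<in> carrier_mat (scalar_dim (n * \<alpha>) C) (n * \<alpha>) \<and> vec_space.row_space (n * \<alpha>) G = C"

text \<open>
  Scalar coordinate of the original word that becomes coordinate \<open>j\<close> after restriction to the
  symbols in the finite set \<open>S\<close>; the symbols in \<open>S\<close> are kept in increasing order.
\<close>

definition thick_index :: "nat \<Rightarrow> nat set \<Rightarrow> nat \<Rightarrow> nat" where
  "thick_index \<alpha> S j = (sorted_list_of_set S ! (j div \<alpha>)) * \<alpha> + j mod \<alpha>"

definition restrict_word :: "nat \<Rightarrow> nat set \<Rightarrow> 'a vec \<Rightarrow> 'a vec" where
  "restrict_word \<alpha> S c = vec (card S * \<alpha>) (\<lambda>j. c $ thick_index \<alpha> S j)"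

definition puncture :: "nat \<Rightarrow> nat set \<Rightarrow> 'a vec set \<Rightarrow> 'a vec set" where
  "puncture \<alpha> S C = restrict_word \<alpha> S ` C"

definition restrict_mat :: "nat \<Rightarrow> nat set \<Rightarrow> 'a mat \<Rightarrow> 'a mat" where
  "restrict_mat \<alpha> S G =
     mat (dim_row G) (card S * \<alpha>) (\<lambda>(i, j). G $$ (i, thick_index \<alpha> S j))"

definition cols_lin_indpt :: "'a::field mat \<Rightarrow> bool" where
  "cols_lin_indpt A \<longleftrightarrow> distinct (cols A) \<and>
     \<not> LinearCombinations.module.lin_dep class_ring (module_vec TYPE('a) (dim_row A)) (set (cols A))"

text \<open>
  The last conjunct is the standing assumption on thick columns. It does not depend on the
  choice of the generator matrix.
\<close>

definition vector_code :: "nat \<Rightarrow> nat \<Rightarrow> 'a::field vec set \<Rightarrow> bool" where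
  "vector_code \<alpha> n C \<longleftrightarrow> 1 \<le> \<alpha> \<and>
     VectorSpace.subspace class_ring C (module_vec TYPE('a) (n * \<alpha>)) \<and>
     (\<forall>G. generator_matrix \<alpha> n C G \<longrightarrow> (\<forall>i<n. cols_lin_indpt (restrict_mat \<alpha> {i} G)))"

definition weight :: "nat \<Rightarrow> nat \<Rightarrow> 'a::zero vec \<Rightarrow> nat" where
  "weight \<alpha> n c = card {i. i < n \<and> symbol \<alpha> c i \<noteq> 0\<^sub>v \<alpha>}"

text \<open>For the zero code this is \<open>Inf {} = 0\<close>, so \<open>d_min \<ge> \<delta> > 0\<close> entails that the code is nonzero.\<close>

definition d_min :: "nat \<Rightarrow> nat \<Rightarrow> 'a::zero vec set \<Rightarrow> nat" where
  "d_min \<alpha> n C = Inf (weight \<alpha> n ` (C - {0\<^sub>v (n * \<alpha>)}))"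

definition regenerating_code ::
  "nat \<Rightarrow> nat \<Rightarrow> nat \<Rightarrow> nat \<Rightarrow> nat \<Rightarrow> nat \<Rightarrow> 'a::field vec set \<Rightarrow> bool" where
  "regenerating_code n k d \<alpha> \<beta> B C \<longleftrightarrow>
     k \<le> d \<and> d < n \<and> vector_code \<alpha> n C \<and> scalar_dim (n * \<alpha>) C = B \<and>
     (\<forall>S. S \<subseteq> {..<n} \<and> card S = k \<longrightarrow>
        (\<forall>c\<in>C. \<forall>c'\<in>C. (\<forall>i\<in>S. symbol \<alpha> c i = symbol \<alpha> c' i) \<longrightarrow> c = c')) \<and>
     (\<forall>i<n. \<forall>D. D \<subseteq> {..<n} - {i} \<and> card D = d \<longrightarrow>
        (\<exists>\<phi>. (\<forall>h\<in>D. linear_map class_ring (module_vec TYPE('a) \<alpha>) (module_vec TYPE('a) \<beta>) (\<phi> h)) \<and>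
             (\<forall>c\<in>C. \<forall>c'\<in>C. (\<forall>h\<in>D. \<phi> h (symbol \<alpha> c h) = \<phi> h (symbol \<alpha> c' h)) \<longrightarrow>
                symbol \<alpha> c i = symbol \<alpha> c' i)))"

definition msr_code ::
  "nat \<Rightarrow> nat \<Rightarrow> nat \<Rightarrow> nat \<Rightarrow> nat \<Rightarrow> 'a::field vec set \<Rightarrow> bool" where
  "msr_code n k d \<alpha> \<beta> C \<longleftrightarrow>
     regenerating_code n k d \<alpha> \<beta> (k * \<alpha>) C \<and> \<alpha> = (d - k + 1) * \<beta>"

definition full_rank_on :: "nat \<Rightarrow> nat \<Rightarrow> 'a::field vec set \<Rightarrow> nat set \<Rightarrow> bool" where
  "full_rank_on \<alpha> n C U \<longleftrightarrow>
     (\<forall>G. generator_matrix \<alpha> n C G \<longrightarrow>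
        vec_space.rank (dim_row G) (restrict_mat \<alpha> U G) = scalar_dim (n * \<alpha>) C)"

definition local_code_at ::
  "nat \<Rightarrow> nat \<Rightarrow> nat \<Rightarrow> nat \<Rightarrow> 'a::field vec set \<Rightarrow> nat set \<Rightarrow> bool" where
  "local_code_at \<alpha> n r \<delta> C S \<longleftrightarrow>
     S \<subseteq> {..<n} \<and> card S \<le> r + \<delta> - 1 \<and> d_min \<alpha> (card S) (puncture \<alpha> S C) \<ge> \<delta>"

definition information_locality ::
  "nat \<Rightarrow> nat \<Rightarrow> nat \<Rightarrow> nat \<Rightarrow> 'a::field vec set \<Rightarrow> bool" where
  "information_locality \<alpha> n r \<delta> C \<longleftrightarrow> vector_code \<alpha> n C \<and>
     (\<exists>\<S>. (\<forall>S\<in>\<S>. local_code_at \<alpha> n r \<delta> C S) \<and> full_rank_on \<alpha> n C (\<Union>\<S>))"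

definition msr_local_codes ::
  "nat \<Rightarrow> nat \<Rightarrow> nat \<Rightarrow> nat \<Rightarrow> nat \<Rightarrow> nat \<Rightarrow> (nat \<Rightarrow> nat set) \<Rightarrow> 'a::field vec set \<Rightarrow> bool" where
  "msr_local_codes \<alpha> n r \<delta> d m S C \<longleftrightarrow>
     (\<forall>i<m. local_code_at \<alpha> n r \<delta> C (S i) \<and> card (S i) = r + \<delta> - 1 \<and>
        (\<exists>\<beta>. msr_code (r + \<delta> - 1) r d \<alpha> \<beta> (puncture \<alpha> (S i) C))) \<and>
     full_rank_on \<alpha> n C (\<Union>i<m. S i)"

definition msr_local_code ::
  "nat \<Rightarrow> nat \<Rightarrow> nat \<Rightarrow> nat \<Rightarrow> 'a::field vec set \<Rightarrow> bool" where
  "msr_local_code \<alpha> n r \<delta> C \<longleftrightarrow>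
     information_locality \<alpha> n r \<delta> C \<and> (\<exists>d m S. msr_local_codes \<alpha> n r \<delta> d m S C)"

text \<open>The block matrix \<open>[A | B]\<close>.\<close>

definition beside :: "'a::zero mat \<Rightarrow> 'a mat \<Rightarrow> 'a mat" where
  "beside A B = four_block_mat A B (0\<^sub>m 0 (dim_col A)) (0\<^sub>m 0 (dim_col B))"

definition stack_copies :: "nat \<Rightarrow> 'a mat \<Rightarrow> 'a mat" where
  "stack_copies m B = mat (m * dim_row B) (dim_col B) (\<lambda>(i, j). B $$ (i mod dim_row B, j))"

definition local_generator :: "nat \<Rightarrow> 'a::zero mat \<Rightarrow> 'a mat \<Rightarrow> 'a mat" where
  "local_generator m G\<^sub>L Q = beside (diag_block_mat (replicate m G\<^sub>L)) (stack_copies m Q)"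

end

theory Submission
  imports Defs
begin

text \<open>
  Encode \<open>v = (v\<^sub>1, \<dots>, v\<^sub>m)\<close> blockwise. The \<open>i\<close>-th local symbols of a codeword form \<open>v\<^sub>i G\<^sub>L\<close>, a puncturing
  of the codeword \<open>v\<^sub>i G\<^sub>0\<close> of the given MSR code, in which any \<open>r\<close> symbols determine the rest. Hence a
  nonzero \<open>v\<^sub>i\<close> contributes weight at least \<open>\<delta>\<close> locally; this settles a message with two nonzero blocks,
  since \<open>2\<delta> \<ge> \<delta> + \<Delta>\<close>. A message with one nonzero block \<open>v\<^sub>i\<close> yields the symbols of \<open>v\<^sub>i G\<^sub>0\<close> padded by
  zeros, of weight at least \<open>\<delta> + \<Delta>\<close>, and equality occurs because some nonzero codeword of the MSR code
  vanishes on \<open>r - 1\<close> prescribed symbols.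
\<close>

section \<open>Rank and kernels\<close>

text \<open>\<open>set (cols A)\<close> forgets repetitions, so distinctness must be recorded beside
  independence. A repeated column makes a difference of two unit vectors a kernel vector; for
  distinct columns a dependence of the set is the same as a nonzero kernel vector.\<close>

lemma (in vec_space) cols_independent_iff_kernel:
  assumes A: "A \<in> carrier_mat n nc"
  shows "distinct (cols A) \<and> lin_indpt (set (cols A)) \<longleftrightarrow>
    (\<forall>v\<in>carrier_vec nc. A *\<^sub>v v = 0\<^sub>v n \<longrightarrow> v = 0\<^sub>v nc)"
proof
  assume "distinct (cols A) \<and> lin_indpt (set (cols A))"
  then show "\<forall>v\<in>carrier_vec nc. A *\<^sub>v v = 0\<^sub>v n \<longrightarrow> v = 0\<^sub>v nc"
    using lin_depI[OF A] by blast
next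
  assume inj: "\<forall>v\<in>carrier_vec nc. A *\<^sub>v v = 0\<^sub>v n \<longrightarrow> v = 0\<^sub>v nc"
  have dist: "distinct (cols A)"
  proof (rule ccontr)
    assume "\<not> distinct (cols A)"
    then obtain i j where ij: "i < nc" "j < nc" "i \<noteq> j" "col A i = col A j"
      using A unfolding distinct_conv_nth by auto
    have eq: "A $$ (l, i) = A $$ (l, j)" if "l < n" for l
      using A ij(1,2) that arg_cong[OF ij(4), of "\<lambda>c. c $ l"] by simp
    have "A *\<^sub>v (unit_vec nc i - unit_vec nc j) = A *\<^sub>v unit_vec nc i - A *\<^sub>v unit_vec nc j"
      using A by (intro mult_minus_distrib_mat_vec) auto
    also have "\<dots> = 0\<^sub>v n"
      using A ij eq by (auto intro!: eq_vecI)
    finally have "unit_vec nc i - unit_vec nc j = (0\<^sub>v nc :: 'a vec)"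
      using inj by auto
    then have "(unit_vec nc i - unit_vec nc j) $ i = (0\<^sub>v nc :: 'a vec) $ i" by simp
    then show False using ij by simp
  qed
  moreover have "lin_indpt (set (cols A))"
  proof (rule notI)
    assume "lin_dep (set (cols A))"
    from lin_depE[OF A this dist] inj show False by blast
  qed
  ultimately show "distinct (cols A) \<and> lin_indpt (set (cols A))" ..
qed

text \<open>Rank counts a maximal independent subset of the set of columns, so it cannot reach
  \<open>nc\<close> if a column is repeated. Full rank thus forces distinct columns, and then it
  coincides with independence.\<close>

lemma (in vec_space) rank_eq_cols_iff_kernel:
  assumes A: "A \<in> carrier_mat n nc"
  shows "rank A = nc \<longleftrightarrow> (\<forall>v\<in>carrier_vec nc. A *\<^sub>v v = 0\<^sub>v n \<longrightarrow> v = 0\<^sub>v nc)"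
proof -
  have "distinct (cols A)" if "rank A = nc"
  proof -
    obtain S where S: "maximal S (\<lambda>T. T \<subseteq> set (cols A) \<and> lin_indpt T)"
      using maximal_exists_superset[of "set (cols A)" "\<lambda>T. T \<subseteq> set (cols A) \<and> lin_indpt T" "{}"]
        finite_lin_indpt2[of "{}"] by auto
    then have "rank A \<le> card (set (cols A))"
      using rank_card_indpt[OF A S] card_mono[of "set (cols A)" S] unfolding maximal_def by auto
    then show ?thesis
      using that A card_distinct[of "cols A"] card_length[of "cols A"] by auto
  qed
  then have "rank A = nc \<longleftrightarrow> distinct (cols A) \<and> lin_indpt (set (cols A))"
    using full_rank_lin_indpt[OF A] lin_indpt_full_rank[OF A] by blast
  then show ?thesis
    unfolding cols_independent_iff_kernel[OF A] .
qed

text \<open>A trivial kernel would mean \<open>nc\<close> distinct independent columns in dimension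
  \<open>nr\<close>. This yields both orthogonal vectors and codewords with prescribed zeros
  below.\<close>

lemma wide_matrix_kernel:
  fixes A :: "'a::field mat"
  assumes A: "A \<in> carrier_mat nr nc" and "nr < nc"
  obtains v where "v \<in> carrier_vec nc" "v \<noteq> 0\<^sub>v nc" "A *\<^sub>v v = 0\<^sub>v nr"
proof (rule ccontr)
  interpret vec_space "TYPE('a)" nr .
  assume "\<not> thesis"
  then have "\<forall>v\<in>carrier_vec nc. A *\<^sub>v v = 0\<^sub>v nr \<longrightarrow> v = 0\<^sub>v nc"
    using that by blast
  then have ind: "distinct (cols A)" "lin_indpt (set (cols A))"
    using cols_independent_iff_kernel[OF A] by auto
  have "card (set (cols A)) \<le> nr"
    using li_le_dim(2)[OF fin_dim _ ind(2)] cols_dim[of A] A dim_is_n by auto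
  then show False using distinct_card[OF ind(1)] A \<open>nr < nc\<close> by simp
qed

text \<open>If a maximal independent set of columns had fewer than \<open>n\<close> elements, some
  nonzero vector would be orthogonal to it, hence to its span and to every column: a nonzero element
  of the left kernel.\<close>

lemma (in vec_space) rank_eq_rows_if_left_kernel:
  assumes A: "A \<in> carrier_mat n nc"
    and inj: "\<And>v. v \<in> carrier_vec n \<Longrightarrow> A\<^sup>T *\<^sub>v v = 0\<^sub>v nc \<Longrightarrow> v = 0\<^sub>v n"
  shows "rank A = n"
proof -
  have cA: "set (cols A) \<subseteq> carrier_vec n" using A cols_dim by blast
  obtain S where S: "maximal S (\<lambda>T. T \<subseteq> set (cols A) \<and> lin_indpt T)"
    using maximal_exists_superset[of "set (cols A)" "\<lambda>T. T \<subseteq> set (cols A) \<and> lin_indpt T" "{}"]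
      finite_lin_indpt2[of "{}"] by auto
  then have S': "S \<subseteq> set (cols A)" "lin_indpt S" "finite S" "S \<subseteq> carrier_vec n"
    using cA finite_subset unfolding maximal_def by blast+
  have rank: "rank A = card S" by (rule rank_card_indpt[OF A S])
  have cols: "set (cols A) \<subseteq> span S"
  proof
    fix c assume c: "c \<in> set (cols A)"
    show "c \<in> span S"
    \<comment> \<open>A column outside the span could be added to \<open>S\<close>, against
      maximality.\<close>
    proof (rule ccontr)
      assume "c \<notin> span S"
      moreover have "c \<notin> S" using \<open>c \<notin> span S\<close> span_mem S'(4) by auto
      ultimately have "lin_indpt (insert c S)"
        using lin_dep_iff_in_span[OF _ S'(2) _ ] S'(4) c cA by auto
      then have "insert c S = S"
        using S S'(1) c unfolding maximal_def by blast
      then show False using \<open>c \<notin> S\<close> by blast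
    qed
  qed
  have "card S \<le> n" using li_le_dim(2)[OF fin_dim _ S'(2)] S'(4) dim_is_n by auto
  moreover have "\<not> card S < n"
  proof
    assume less: "card S < n"
    obtain xs where xs: "set xs = S" "distinct xs" using S'(3) finite_distinct_list by blast
    \<comment> \<open>The kernel of the matrix with rows \<open>S\<close> is the orthogonal
      complement of \<open>S\<close>; with fewer than \<open>n\<close> rows that kernel is
      nonzero.\<close>
    define M where "M = mat_of_rows n xs"
    have M: "M \<in> carrier_mat (card S) n"
      using distinct_card[OF xs(2)] xs(1) by (auto simp: M_def)
    obtain y where y: "y \<in> carrier_vec n" "y \<noteq> 0\<^sub>v n" "M *\<^sub>v y = 0\<^sub>v (card S)"
      using wide_matrix_kernel[OF M less] .
    have "y \<bullet> s = 0" if "s \<in> S" for s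
    proof -
      have "s \<in> set xs" using that xs(1) by simp
      then obtain i where "i < length xs" "xs ! i = s" unfolding in_set_conv_nth by blast
      then have i: "i < card S" "s = xs ! i" using distinct_card[OF xs(2)] xs(1) by simp_all
      have "s \<in> carrier_vec n" using that S'(4) by blast
      then have "row M i = s"
        using i distinct_card[OF xs(2)] xs(1) by (simp add: M_def)
      moreover have "row M i \<bullet> y = (M *\<^sub>v y) $ i" using M i by simp
      ultimately show ?thesis using y(3) i comm_scalar_prod[OF y(1) \<open>s \<in> carrier_vec n\<close>] by simp
    qed
    then have "y \<in> orthogonal_complement (span S)"
      unfolding in_orthogonal_complement_span[OF S'(4)] using y(1)
      by (auto simp: orthogonal_complement_def)
    then have orth: "y \<bullet> c = 0" if "c \<in> set (cols A)" for c
      using that cols by (auto simp: orthogonal_complement_def)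
    have "A\<^sup>T *\<^sub>v y = 0\<^sub>v nc"
    proof (rule eq_vecI)
      fix i assume "i < dim_vec (0\<^sub>v nc :: 'a vec)"
      then have i: "i < nc" by simp
      then have "col A i \<in> set (cols A)" using A by (auto simp: cols_def)
      then show "(A\<^sup>T *\<^sub>v y) $ i = 0\<^sub>v nc $ i"
        using orth comm_scalar_prod[OF y(1), of "col A i"] A i by auto
    qed (use A in auto)
    then show False using inj y by blast
  qed
  ultimately show ?thesis using rank by simp
qed

lemma cols_lin_indpt_iff_kernel:
  fixes A :: "'a::field mat"
  assumes "A \<in> carrier_mat nr nc"
  shows "cols_lin_indpt A \<longleftrightarrow> (\<forall>v\<in>carrier_vec nc. A *\<^sub>v v = 0\<^sub>v nr \<longrightarrow> v = 0\<^sub>v nc)"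
  using vec_space.cols_independent_iff_kernel[OF assms] assms unfolding cols_lin_indpt_def by simp

section \<open>Row spaces as images of encoding maps\<close>

lemma scalar_dim_row_space:
  fixes A :: "'a::field mat"
  shows "scalar_dim N (vec_space.row_space N A) = vec_space.rank N A\<^sup>T"
  unfolding scalar_dim_def vec_space.row_space_def vec_space.rank_def by simp

lemma row_space_conv_image:
  fixes A :: "'a::field mat"
  assumes "A \<in> carrier_mat nr N"
  shows "vec_space.row_space N A = (\<lambda>v. A\<^sup>T *\<^sub>v v) ` carrier_vec nr"
  using vec_space.row_space_eq[OF assms] assms by auto

lemma subspace_row_space:
  fixes A :: "'a::field mat"
  assumes "A \<in> carrier_mat nr N"
  shows "VectorSpace.subspace class_ring (vec_space.row_space N A) (module_vec TYPE('a) N)"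
proof -
  interpret vec_space "TYPE('a)" N .
  have "set (rows A) \<subseteq> carrier_vec N" using assms rows_carrier[of A] by (simp add: carrier_matD)
  then show ?thesis unfolding row_space_def using span_is_subspace by auto
qed

text \<open>The dimension of the row space is the rank of the transpose, so it reaches the number of
  rows exactly when encoding is injective.\<close>

lemma scalar_dim_row_space_iff:
  fixes A :: "'a::field mat"
  assumes A: "A \<in> carrier_mat nr N"
  shows "scalar_dim N (vec_space.row_space N A) = nr \<longleftrightarrow>
    (\<forall>v\<in>carrier_vec nr. A\<^sup>T *\<^sub>v v = 0\<^sub>v N \<longrightarrow> v = 0\<^sub>v nr)"
proof -
  have "A\<^sup>T \<in> carrier_mat N nr" using A by simp
  then show ?thesis unfolding scalar_dim_row_space by (fact vec_space.rank_eq_cols_iff_kernel)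
qed

section \<open>Symbols and restrictions\<close>

lemma block_index_less:
  assumes "b < m" "t < (k::nat)"
  shows "b * k + t < m * k"
proof -
  have "b * k + t < Suc b * k" using assms(2) by simp
  also have "\<dots> \<le> m * k" using assms(1) by (intro mult_le_mono1) simp
  finally show ?thesis .
qed

lemma symbol_carrier [simp]: "symbol \<alpha> c i \<in> carrier_vec \<alpha>"
  by (simp add: symbol_def)

lemma dim_symbol [simp]: "dim_vec (symbol \<alpha> c i) = \<alpha>"
  by (simp add: symbol_def)

lemma index_symbol [simp]: "t < \<alpha> \<Longrightarrow> symbol \<alpha> c i $ t = c $ (i * \<alpha> + t)"
  by (simp add: symbol_def)

lemma symbol_zero [simp]: "i < n \<Longrightarrow> symbol \<alpha> (0\<^sub>v (n * \<alpha>)) i = 0\<^sub>v \<alpha>"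
  by (rule eq_vecI) (auto simp: block_index_less)

text \<open>\<open>symbol\<close> is used at two scales: at size \<open>k * \<alpha>\<close> it cuts
  out a group of \<open>k\<close> consecutive symbols, and here such a group is cut further into its
  members.\<close>

lemma symbol_symbol: "s < k \<Longrightarrow> symbol \<alpha> (symbol (k * \<alpha>) c b) s = symbol \<alpha> c (b * k + s)"
  by (rule eq_vecI) (auto simp: block_index_less add_mult_distrib mult.assoc add.assoc)

lemma eq_vec_symbolI:
  assumes "c \<in> carrier_vec (n * \<alpha>)" "c' \<in> carrier_vec (n * \<alpha>)"
    and "\<And>i. i < n \<Longrightarrow> symbol \<alpha> c i = symbol \<alpha> c' i"
  shows "c = c'"
proof (rule eq_vecI)
  fix j assume "j < dim_vec c'"
  then have j: "j < n * \<alpha>" using assms by simp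
  \<comment> \<open>The existence of a coordinate \<open>j\<close> excludes \<alpha> = 0, so
    quotient and remainder by \<alpha> give its symbol and its position there.\<close>
  then have "0 < \<alpha>" by (cases \<alpha>) auto
  then have "j mod \<alpha> < \<alpha>" "j div \<alpha> < n"
    using j by (auto simp: less_mult_imp_div_less)
  then show "c $ j = c' $ j"
    using arg_cong[OF assms(3), of "j div \<alpha>" "\<lambda>x. x $ (j mod \<alpha>)"] by simp
qed (use assms in simp)

lemma symbol_append_left:
  assumes "x \<in> carrier_vec (a * \<alpha>)" "y \<in> carrier_vec (b * \<alpha>)" "i < a"
  shows "symbol \<alpha> (x @\<^sub>v y) i = symbol \<alpha> x i"
  using assms by (intro eq_vecI) (auto simp: block_index_less trans_less_add1)

lemma symbol_append_right:
  assumes "x \<in> carrier_vec (a * \<alpha>)" "y \<in> carrier_vec (b * \<alpha>)" "i < b"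
  shows "symbol \<alpha> (x @\<^sub>v y) (a + i) = symbol \<alpha> y i"
  using assms by (intro eq_vecI) (auto simp: block_index_less add_mult_distrib add.assoc)

lemma thick_index_interval:
  assumes "j < k * \<alpha>"
  shows "thick_index \<alpha> {a..<a + k} j = a * \<alpha> + j"
proof -
  have "j div \<alpha> < k" using assms by (simp add: less_mult_imp_div_less)
  then show ?thesis by (simp add: thick_index_def algebra_simps)
qed

text \<open>Consecutive symbols keep their order and are adjacent, so restricting to them amounts to
  reading one symbol of a coarser size. Sets of nodes are written in this interval form below to
  make the equation applicable.\<close>

lemma restrict_word_block: "restrict_word \<alpha> {b * k..<b * k + k} c = symbol (k * \<alpha>) c b"
  by (rule eq_vecI) (auto simp: restrict_word_def thick_index_interval mult.assoc)

lemma thick_index_less: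
  assumes "S \<subseteq> {..<n}" "j < card S * \<alpha>"
  shows "thick_index \<alpha> S j < n * \<alpha>"
proof -
  have "finite S" using assms(1) finite_subset by blast
  have "0 < \<alpha>" using assms(2) by (cases \<alpha>) auto
  have "j div \<alpha> < card S" using assms(2) by (simp add: less_mult_imp_div_less)
  then have "sorted_list_of_set S ! (j div \<alpha>) \<in> set (sorted_list_of_set S)"
    by (intro nth_mem) simp
  then have "sorted_list_of_set S ! (j div \<alpha>) < n" using assms(1) \<open>finite S\<close> by auto
  then show ?thesis
    unfolding thick_index_def by (rule block_index_less) (use \<open>0 < \<alpha>\<close> in simp)
qed

lemma restrict_word_transpose_mult:
  fixes G :: "'a::field mat"
  assumes G: "G \<in> carrier_mat K (n * \<alpha>)" and S: "S \<subseteq> {..<n}" and v: "v \<in> carrier_vec K"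
  shows "restrict_word \<alpha> S (G\<^sup>T *\<^sub>v v) = (restrict_mat \<alpha> S G)\<^sup>T *\<^sub>v v"
proof (rule eq_vecI)
  fix j assume "j < dim_vec ((restrict_mat \<alpha> S G)\<^sup>T *\<^sub>v v)"
  then have j: "j < card S * \<alpha>" by (simp add: restrict_mat_def)
  then show "restrict_word \<alpha> S (G\<^sup>T *\<^sub>v v) $ j = ((restrict_mat \<alpha> S G)\<^sup>T *\<^sub>v v) $ j"
    using G v thick_index_less[OF S j]
    by (auto simp: restrict_word_def restrict_mat_def scalar_prod_def)
qed (simp add: restrict_mat_def restrict_word_def)

lemma symbol_transpose_mult:
  fixes G :: "'a::field mat"
  assumes "G \<in> carrier_mat K (n * \<alpha>)" "i < n" "v \<in> carrier_vec K"
  shows "symbol \<alpha> (G\<^sup>T *\<^sub>v v) i = (restrict_mat \<alpha> {i} G)\<^sup>T *\<^sub>v v"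
proof -
  \<comment> \<open>Block length 1 turns the interval into the singleton \<open>{i}\<close>.\<close>
  have "symbol \<alpha> (G\<^sup>T *\<^sub>v v) i = restrict_word \<alpha> {i} (G\<^sup>T *\<^sub>v v)"
    using restrict_word_block[of \<alpha> i 1 "G\<^sup>T *\<^sub>v v"] by simp
  then show ?thesis using restrict_word_transpose_mult[of G K n \<alpha> "{i}" v] assms by simp
qed

text \<open>Transposition moves the thick column across the scalar product, so its kernel consists
  of the vectors orthogonal to every i-th symbol of the code. The right-hand side depends only on
  the row space; hence the standing assumption can be checked or used with any one generator
  matrix.\<close>

lemma cols_lin_indpt_thick_column_iff:
  fixes G :: "'a::field mat"
  assumes G: "G \<in> carrier_mat K (n * \<alpha>)" and i: "i < n"
  shows "cols_lin_indpt (restrict_mat \<alpha> {i} G) \<longleftrightarrow>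
    (\<forall>w\<in>carrier_vec \<alpha>. (\<forall>c\<in>vec_space.row_space (n * \<alpha>) G. symbol \<alpha> c i \<bullet> w = 0) \<longrightarrow> w = 0\<^sub>v \<alpha>)"
proof -
  let ?R = "restrict_mat \<alpha> {i} G"
  have R: "?R \<in> carrier_mat K \<alpha>" using G by (simp add: restrict_mat_def)
  have "?R *\<^sub>v w = 0\<^sub>v K \<longleftrightarrow> (\<forall>v\<in>carrier_vec K. symbol \<alpha> (G\<^sup>T *\<^sub>v v) i \<bullet> w = 0)"
    if w: "w \<in> carrier_vec \<alpha>" for w
  proof -
    have "symbol \<alpha> (G\<^sup>T *\<^sub>v v) i \<bullet> w = v \<bullet> (?R *\<^sub>v w)" if "v \<in> carrier_vec K" for v
      using symbol_transpose_mult[OF G i that] transpose_vec_mult_scalar[OF R w that] by simp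
    moreover have "x = 0\<^sub>v K" if x: "x \<in> carrier_vec K" "\<forall>v\<in>carrier_vec K. v \<bullet> x = 0" for x :: "'a vec"
    proof (rule eq_vecI)
      fix j assume "j < dim_vec (0\<^sub>v K :: 'a vec)"
      then have j: "j < K" by simp
      have "unit_vec K j \<bullet> x = 0" using x(2) by simp
      then show "x $ j = 0\<^sub>v K $ j" using x(1) j by simp
    qed (use x(1) in simp)
    ultimately show ?thesis using R w by auto
  qed
  then show ?thesis
    unfolding cols_lin_indpt_iff_kernel[OF R] row_space_conv_image[OF G] by auto
qed

lemma vector_codeI:
  fixes C :: "'a::field vec set"
  assumes "1 \<le> \<alpha>" "VectorSpace.subspace class_ring C (module_vec TYPE('a) (n * \<alpha>))"
    and "\<And>i w. i < n \<Longrightarrow> w \<in> carrier_vec \<alpha> \<Longrightarrow> (\<And>c. c \<in> C \<Longrightarrow> symbol \<alpha> c i \<bullet> w = 0) \<Longrightarrow> w = 0\<^sub>v \<alpha>"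
  shows "vector_code \<alpha> n C"
  unfolding vector_code_def
proof (intro conjI allI impI)
  fix G i assume G: "generator_matrix \<alpha> n C G" and i: "i < n"
  then have "G \<in> carrier_mat (scalar_dim (n * \<alpha>) C) (n * \<alpha>)" "vec_space.row_space (n * \<alpha>) G = C"
    by (auto simp: generator_matrix_def)
  then show "cols_lin_indpt (restrict_mat \<alpha> {i} G)"
    using cols_lin_indpt_thick_column_iff[OF _ i] assms(3)[OF i] by blast
qed (use assms in auto)

lemma vector_codeD:
  assumes "vector_code \<alpha> n C" "generator_matrix \<alpha> n C G" "i < n" "w \<in> carrier_vec \<alpha>"
    and "\<And>c. c \<in> C \<Longrightarrow> symbol \<alpha> c i \<bullet> w = 0"
  shows "w = 0\<^sub>v \<alpha>"
proof -
  have "cols_lin_indpt (restrict_mat \<alpha> {i} G)" using assms by (simp add: vector_code_def)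
  moreover have "G \<in> carrier_mat (scalar_dim (n * \<alpha>) C) (n * \<alpha>)" "vec_space.row_space (n * \<alpha>) G = C"
    using assms by (auto simp: generator_matrix_def)
  ultimately show ?thesis
    using cols_lin_indpt_thick_column_iff[OF _ \<open>i < n\<close>] assms(4,5) by blast
qed

section \<open>Weights\<close>

text \<open>Distance bounds come from counting zero symbols, since reconstruction limits how many a
  nonzero codeword can have.\<close>

lemma weight_eq_diff_zeros:
  "weight \<alpha> n c = n - card {i. i < n \<and> symbol \<alpha> c i = 0\<^sub>v \<alpha>}"
proof -
  have "{i. i < n \<and> symbol \<alpha> c i \<noteq> 0\<^sub>v \<alpha>} = {..<n} - {i. i < n \<and> symbol \<alpha> c i = 0\<^sub>v \<alpha>}" by auto
  then show ?thesis by (simp add: weight_def card_Diff_subset subset_eq)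
qed

lemma card_less_add:
  "card {i. i < a + b \<and> P i} = card {i. i < a \<and> P i} + card {i. i < b \<and> P (a + i)}" for a b :: nat
proof -
  have "{i. i < a + b \<and> P i} = {i. i < a \<and> P i} \<union> (+) a ` {i. i < b \<and> P (a + i)}"
  proof (intro Set.set_eqI iffI)
    fix i assume i: "i \<in> {i. i < a + b \<and> P i}"
    show "i \<in> {i. i < a \<and> P i} \<union> (+) a ` {i. i < b \<and> P (a + i)}"
    proof (cases "i < a")
      case False
      then have "i = a + (i - a)" by simp
      then show ?thesis using i by (intro UnI2 image_eqI[where x = "i - a"]) auto
    qed (use i in auto)
  qed auto
  moreover have "{i. i < a \<and> P i} \<inter> (+) a ` {i. i < b \<and> P (a + i)} = {}" by auto
  ultimately show ?thesis
    by (simp add: card_Un_disjoint card_image)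
qed

lemma card_less_mult:
  "card {i. i < m * k \<and> P i} = (\<Sum>b<m. card {s. s < k \<and> P (b * k + s)})" for m k :: nat
proof (induction m)
  case (Suc m)
  have "{i. i < Suc m * k \<and> P i} = {i. i < m * k + k \<and> P i}" by (simp add: add.commute)
  then show ?case using Suc by (simp only: card_less_add) simp
qed simp

text \<open>A nonzero codeword has to be exhibited, because \<open>Inf {} = 0\<close> would make a
  positive bound false for the zero code.\<close>

lemma d_min_geI:
  assumes "\<And>c. c \<in> C \<Longrightarrow> c \<noteq> 0\<^sub>v (n * \<alpha>) \<Longrightarrow> w \<le> weight \<alpha> n c"
    and "c \<in> C" "c \<noteq> 0\<^sub>v (n * \<alpha>)"
  shows "w \<le> d_min \<alpha> n C"
  unfolding d_min_def
proof (rule cInf_greatest)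
  show "weight \<alpha> n ` (C - {0\<^sub>v (n * \<alpha>)}) \<noteq> {}" using assms(2,3) by blast
  show "w \<le> x" if "x \<in> weight \<alpha> n ` (C - {0\<^sub>v (n * \<alpha>)})" for x
    using that assms(1) by blast
qed

lemma d_min_eqI:
  assumes "\<And>c. c \<in> C \<Longrightarrow> c \<noteq> 0\<^sub>v (n * \<alpha>) \<Longrightarrow> w \<le> weight \<alpha> n c"
    and c: "c \<in> C" "c \<noteq> 0\<^sub>v (n * \<alpha>)" "weight \<alpha> n c \<le> w"
  shows "d_min \<alpha> n C = w"
proof (rule antisym)
  have "d_min \<alpha> n C \<le> weight \<alpha> n c"
    unfolding d_min_def using c(1,2) by (intro cInf_lower) auto
  then show "d_min \<alpha> n C \<le> w" using c(3) by simp
  show "w \<le> d_min \<alpha> n C" by (rule d_min_geI[OF assms(1) c(1,2)])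
qed

section \<open>Block matrices\<close>

lemma index_transpose_mult_vec:
  fixes A :: "'a::field mat"
  assumes "A \<in> carrier_mat nr nc" "v \<in> carrier_vec nr" "j < nc"
  shows "(A\<^sup>T *\<^sub>v v) $ j = (\<Sum>i<nr. A $$ (i, j) * v $ i)"
  using assms by (simp add: scalar_prod_def lessThan_atLeast0)

lemma beside_carrier:
  assumes "A \<in> carrier_mat k a" "B \<in> carrier_mat k b"
  shows "beside A B \<in> carrier_mat k (a + b)"
  using assms by (intro carrier_matI) (simp_all add: beside_def)

lemma index_beside:
  assumes "A \<in> carrier_mat k a" "B \<in> carrier_mat k b" "i < k" "j < a + b"
  shows "beside A B $$ (i, j) = (if j < a then A $$ (i, j) else B $$ (i, j - a))"
  using assms by (simp add: beside_def)

lemma transpose_beside_mult: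
  fixes A B :: "'a::field mat"
  assumes A: "A \<in> carrier_mat k a" and B: "B \<in> carrier_mat k b" and v: "v \<in> carrier_vec k"
  shows "(beside A B)\<^sup>T *\<^sub>v v = (A\<^sup>T *\<^sub>v v) @\<^sub>v (B\<^sup>T *\<^sub>v v)"
proof (rule eq_vecI)
  fix j assume "j < dim_vec ((A\<^sup>T *\<^sub>v v) @\<^sub>v (B\<^sup>T *\<^sub>v v))"
  then have j: "j < a + b" using A B by simp
  have "((beside A B)\<^sup>T *\<^sub>v v) $ j = (\<Sum>i<k. beside A B $$ (i, j) * v $ i)"
    by (rule index_transpose_mult_vec[OF beside_carrier[OF A B] v j])
  also have "\<dots> = (\<Sum>i<k. (if j < a then A $$ (i, j) else B $$ (i, j - a)) * v $ i)"
    using index_beside[OF A B _ j] by (intro sum.cong) simp_all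
  also have "\<dots> = ((A\<^sup>T *\<^sub>v v) @\<^sub>v (B\<^sup>T *\<^sub>v v)) $ j"
  proof (cases "j < a")
    case True
    then show ?thesis
      using A index_transpose_mult_vec[OF A v True] by (simp del: index_mult_mat_vec)
  next
    case False
    then have "j - a < b" using j by simp
    then show ?thesis
      using A B j False index_transpose_mult_vec[OF B v, of "j - a"]
      by (simp del: index_mult_mat_vec)
  qed
  finally show "((beside A B)\<^sup>T *\<^sub>v v) $ j = ((A\<^sup>T *\<^sub>v v) @\<^sub>v (B\<^sup>T *\<^sub>v v)) $ j" .
qed (use A B beside_carrier[OF A B] in simp)

lemma dim_diag_block_mat_replicate [simp]:
  "dim_row (diag_block_mat (replicate m A)) = m * dim_row A"
  "dim_col (diag_block_mat (replicate m A)) = m * dim_col A"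
  by (simp_all add: dim_diag_block_mat sum_list_replicate)

text \<open>\<open>diag_block_mat\<close> peels off the first block, so the induction compares
  \<open>b\<close> and \<open>b'\<close> with 0: both zero hits the block just removed, exactly one
  zero gives a zero block, and otherwise both drop by one.\<close>

lemma index_diag_block_mat_replicate:
  assumes "A \<in> carrier_mat k l" "b < m" "b' < m" "t < k" "j < l"
  shows "diag_block_mat (replicate m A) $$ (b * k + t, b' * l + j) = (if b = b' then A $$ (t, j) else 0)"
  using assms(2,3)
proof (induction m arbitrary: b b')
  case (Suc m)
  have *: "b * k + t < k + m * k" "b' * l + j < l + m * l"
    using Suc.prems assms block_index_less[of b "Suc m" t k] block_index_less[of b' "Suc m" j l] by auto
  show ?case
    using assms(1,4,5) Suc * by (cases b; cases b') (auto simp: Let_def)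
qed simp

lemma sum_blocks: "(\<Sum>i<m * k. f i) = (\<Sum>b<m. \<Sum>t<k. f (b * k + t :: nat))"
proof -
  have "(\<Sum>t<k. f (b * k + t)) = sum f {b * k..<b * k + k}" for b
    using sum.shift_bounds_nat_ivl[of f 0 "b * k" k] by (simp add: lessThan_atLeast0 add.commute)
  then show ?thesis by (simp add: sum.nat_group)
qed

lemma local_generator_carrier:
  assumes "A \<in> carrier_mat k l" "B \<in> carrier_mat k q"
  shows "local_generator m A B \<in> carrier_mat (m * k) (m * l + q)"
  using assms unfolding local_generator_def
  by (intro beside_carrier) (auto simp: stack_copies_def)

text \<open>Block column \<open>b\<close> of the diagonal part has its only copy of \<open>A\<close>
  in block row \<open>b\<close>, so the b-th local group sees only message block
  \<open>b\<close>.\<close>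

lemma local_generator_local_part:
  fixes A B :: "'a::field mat"
  assumes A: "A \<in> carrier_mat k l" and B: "B \<in> carrier_mat k q"
    and v: "v \<in> carrier_vec (m * k)" and b: "b < m"
  shows "symbol l ((local_generator m A B)\<^sup>T *\<^sub>v v) b = A\<^sup>T *\<^sub>v symbol k v b"
proof (rule eq_vecI)
  let ?D = "diag_block_mat (replicate m A)"
  fix j assume "j < dim_vec (A\<^sup>T *\<^sub>v symbol k v b)"
  then have j: "j < l" using A by simp
  have D: "?D \<in> carrier_mat (m * k) (m * l)" using A by auto
  have S: "stack_copies m B \<in> carrier_mat (m * k) q" using B by (simp add: stack_copies_def)
  have "symbol l ((local_generator m A B)\<^sup>T *\<^sub>v v) b $ j = (?D\<^sup>T *\<^sub>v v) $ (b * l + j)"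
    unfolding local_generator_def transpose_beside_mult[OF D S v]
    using j A block_index_less[OF b j] by simp
  also have "\<dots> = (\<Sum>i<m * k. ?D $$ (i, b * l + j) * v $ i)"
    by (rule index_transpose_mult_vec[OF D v block_index_less[OF b j]])
  also have "\<dots> = (\<Sum>b'<m. if b' = b then \<Sum>t<k. A $$ (t, j) * v $ (b * k + t) else 0)"
    unfolding sum_blocks
    by (rule sum.cong) (auto simp: index_diag_block_mat_replicate[OF A _ b _ j])
  also have "\<dots> = (\<Sum>t<k. A $$ (t, j) * v $ (b * k + t))"
    using b by simp
  also have "\<dots> = (A\<^sup>T *\<^sub>v symbol k v b) $ j"
    using index_transpose_mult_vec[OF A _ j, of "symbol k v b"] by simp
  finally show "symbol l ((local_generator m A B)\<^sup>T *\<^sub>v v) b $ j = (A\<^sup>T *\<^sub>v symbol k v b) $ j" .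
qed (use A in auto)

text \<open>The stacked copies add up the contributions of all message blocks. With a single
  possibly nonzero block the sum collapses to what \<open>B\<close> makes of that block.\<close>

lemma local_generator_global_part:
  fixes A B :: "'a::field mat"
  assumes A: "A \<in> carrier_mat k (a * \<alpha>)" and B: "B \<in> carrier_mat k (q * \<alpha>)"
    and v: "v \<in> carrier_vec (m * k)" and b: "b < m" and s: "s < q"
    and zero: "\<And>b'. b' < m \<Longrightarrow> b' \<noteq> b \<Longrightarrow> symbol k v b' = 0\<^sub>v k"
  shows "symbol \<alpha> ((local_generator m A B)\<^sup>T *\<^sub>v v) (m * a + s) = symbol \<alpha> (B\<^sup>T *\<^sub>v symbol k v b) s"
proof -
  let ?D = "diag_block_mat (replicate m A)" and ?S = "stack_copies m B"
  have D: "?D \<in> carrier_mat (m * k) (m * (a * \<alpha>))" using A by auto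
  have S: "?S \<in> carrier_mat (m * k) (q * \<alpha>)" using B by (simp add: stack_copies_def)
  have "?S\<^sup>T *\<^sub>v v = B\<^sup>T *\<^sub>v symbol k v b"
  proof (rule eq_vecI)
    fix j assume "j < dim_vec (B\<^sup>T *\<^sub>v symbol k v b)"
    then have j: "j < q * \<alpha>" using B by simp
    have "(?S\<^sup>T *\<^sub>v v) $ j = (\<Sum>i<m * k. ?S $$ (i, j) * v $ i)"
      by (rule index_transpose_mult_vec[OF S v j])
    also have "\<dots> = (\<Sum>b'<m. \<Sum>t<k. B $$ (t, j) * symbol k v b' $ t)"
      unfolding sum_blocks using B j by (intro sum.cong) (auto simp: stack_copies_def block_index_less)
    also have "\<dots> = (\<Sum>b'<m. if b' = b then \<Sum>t<k. B $$ (t, j) * symbol k v b $ t else 0)"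
      using zero by (intro sum.cong) (auto intro!: sum.neutral simp del: index_symbol)
    also have "\<dots> = (\<Sum>t<k. B $$ (t, j) * symbol k v b $ t)" using b by simp
    also have "\<dots> = (B\<^sup>T *\<^sub>v symbol k v b) $ j"
      by (rule index_transpose_mult_vec[OF B symbol_carrier j, symmetric])
    finally show "(?S\<^sup>T *\<^sub>v v) $ j = (B\<^sup>T *\<^sub>v symbol k v b) $ j" .
  qed (use S B in auto)
  moreover have "?D\<^sup>T *\<^sub>v v \<in> carrier_vec (m * a * \<alpha>)"
    by (rule carrier_vecI) (use A in \<open>simp add: mult.assoc\<close>)
  moreover have "?S\<^sup>T *\<^sub>v v \<in> carrier_vec (q * \<alpha>)"
    by (rule carrier_vecI) (use S in simp)
  ultimately show ?thesis
    unfolding local_generator_def transpose_beside_mult[OF D S v]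
    using symbol_append_right[OF _ _ s, of "?D\<^sup>T *\<^sub>v v" "m * a" \<alpha> "?S\<^sup>T *\<^sub>v v"] by simp
qed

section \<open>The code generated by \<open>local_generator\<close>\<close>

text \<open>For \<open>b < m\<close>, a right inverse of reading message block \<open>b\<close>;
  single-block messages reduce questions about the large code to the given MSR code.\<close>

definition embed_block :: "nat \<Rightarrow> nat \<Rightarrow> nat \<Rightarrow> 'a::zero vec \<Rightarrow> 'a vec" where
  "embed_block m k b x = vec (m * k) (\<lambda>i. if i div k = b then x $ (i mod k) else 0)"

lemma embed_block_carrier [simp]: "embed_block m k b x \<in> carrier_vec (m * k)"
  by (simp add: embed_block_def)

lemma symbol_embed_block:
  assumes "x \<in> carrier_vec k" "b' < m"
  shows "symbol k (embed_block m k b x) b' = (if b' = b then x else 0\<^sub>v k)"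
  using assms by (intro eq_vecI) (auto simp: embed_block_def block_index_less)

section \<open>The given MSR code and its split generator matrix\<close>

locale msr_code_splitting =
  fixes r \<delta> \<Delta> d \<alpha> \<beta> L :: nat and C\<^sub>0 :: "'a::field vec set" and G\<^sub>L Q :: "'a mat"
  assumes r: "1 \<le> r" and \<delta>: "1 \<le> \<delta>"
    and L: "L = r + \<delta> - 1"
    and d_less: "d < L"
    and msr: "msr_code (L + \<Delta>) r d \<alpha> \<beta> C\<^sub>0"
    and G\<^sub>L: "G\<^sub>L \<in> carrier_mat (r * \<alpha>) (L * \<alpha>)"
    and Q: "Q \<in> carrier_mat (r * \<alpha>) (\<Delta> * \<alpha>)"
    and gen\<^sub>0: "generator_matrix \<alpha> (L + \<Delta>) C\<^sub>0 (beside G\<^sub>L Q)"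
begin

abbreviation "G\<^sub>0 \<equiv> beside G\<^sub>L Q"

lemma regenerating\<^sub>0: "regenerating_code (L + \<Delta>) r d \<alpha> \<beta> (r * \<alpha>) C\<^sub>0"
  using msr unfolding msr_code_def by (rule conjunct1)

lemma \<alpha>_eq: "\<alpha> = (d - r + 1) * \<beta>"
  using msr unfolding msr_code_def by (rule conjunct2)

lemma r_le_d: "r \<le> d"
  using regenerating\<^sub>0 unfolding regenerating_code_def by (elim conjE)

lemma code\<^sub>0: "vector_code \<alpha> (L + \<Delta>) C\<^sub>0"
  using regenerating\<^sub>0 unfolding regenerating_code_def by (elim conjE)

lemma dim\<^sub>0: "scalar_dim ((L + \<Delta>) * \<alpha>) C\<^sub>0 = r * \<alpha>"
  using regenerating\<^sub>0 unfolding regenerating_code_def by (elim conjE)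

lemma \<alpha>_pos: "1 \<le> \<alpha>"
  using code\<^sub>0 by (simp add: vector_code_def)

lemma r_le_L: "r \<le> L" using L \<delta> by simp

lemma G\<^sub>0: "G\<^sub>0 \<in> carrier_mat (r * \<alpha>) ((L + \<Delta>) * \<alpha>)"
  using beside_carrier[OF G\<^sub>L Q] by (simp add: add_mult_distrib)

lemma row_space\<^sub>0: "vec_space.row_space ((L + \<Delta>) * \<alpha>) G\<^sub>0 = C\<^sub>0"
  using gen\<^sub>0 by (simp add: generator_matrix_def)

lemma C\<^sub>0_conv_image: "C\<^sub>0 = (\<lambda>v. G\<^sub>0\<^sup>T *\<^sub>v v) ` carrier_vec (r * \<alpha>)"
  using row_space_conv_image[OF G\<^sub>0] row_space\<^sub>0 by simp

lemma word\<^sub>0: "v \<in> carrier_vec (r * \<alpha>) \<Longrightarrow> G\<^sub>0\<^sup>T *\<^sub>v v \<in> C\<^sub>0"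
  using C\<^sub>0_conv_image by blast

text \<open>A generator matrix has as many rows as the dimension, so encoding is injective.\<close>

lemma inj\<^sub>0:
  assumes "v \<in> carrier_vec (r * \<alpha>)" "G\<^sub>0\<^sup>T *\<^sub>v v = 0\<^sub>v ((L + \<Delta>) * \<alpha>)"
  shows "v = 0\<^sub>v (r * \<alpha>)"
  using scalar_dim_row_space_iff[OF G\<^sub>0] row_space\<^sub>0 dim\<^sub>0 assms by blast

lemma symbol\<^sub>0_local:
  assumes "v \<in> carrier_vec (r * \<alpha>)" "i < L"
  shows "symbol \<alpha> (G\<^sub>0\<^sup>T *\<^sub>v v) i = symbol \<alpha> (G\<^sub>L\<^sup>T *\<^sub>v v) i"
proof -
  have "G\<^sub>L\<^sup>T *\<^sub>v v \<in> carrier_vec (L * \<alpha>)" "Q\<^sup>T *\<^sub>v v \<in> carrier_vec (\<Delta> * \<alpha>)"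
    using G\<^sub>L Q by (auto intro!: carrier_vecI)
  then show ?thesis
    unfolding transpose_beside_mult[OF G\<^sub>L Q assms(1)] using symbol_append_left assms(2) by blast
qed

lemma symbol\<^sub>0_global:
  assumes "v \<in> carrier_vec (r * \<alpha>)" "s < \<Delta>"
  shows "symbol \<alpha> (G\<^sub>0\<^sup>T *\<^sub>v v) (L + s) = symbol \<alpha> (Q\<^sup>T *\<^sub>v v) s"
proof -
  have "G\<^sub>L\<^sup>T *\<^sub>v v \<in> carrier_vec (L * \<alpha>)" "Q\<^sup>T *\<^sub>v v \<in> carrier_vec (\<Delta> * \<alpha>)"
    using G\<^sub>L Q by (auto intro!: carrier_vecI)
  then show ?thesis
    unfolding transpose_beside_mult[OF G\<^sub>L Q assms(1)] using symbol_append_right assms(2) by blast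
qed

lemma determined\<^sub>0:
  assumes "S \<subseteq> {..<L + \<Delta>}" "card S = r" "c \<in> C\<^sub>0" "c' \<in> C\<^sub>0"
    and "\<And>i. i \<in> S \<Longrightarrow> symbol \<alpha> c i = symbol \<alpha> c' i"
  shows "c = c'"
proof -
  have "\<forall>S. S \<subseteq> {..<L + \<Delta>} \<and> card S = r \<longrightarrow>
      (\<forall>c\<in>C\<^sub>0. \<forall>c'\<in>C\<^sub>0. (\<forall>i\<in>S. symbol \<alpha> c i = symbol \<alpha> c' i) \<longrightarrow> c = c')"
    using regenerating\<^sub>0 unfolding regenerating_code_def by (elim conjE)
  then show ?thesis using assms by blast
qed

lemma repair\<^sub>0:
  assumes "i < L + \<Delta>" "D \<subseteq> {..<L + \<Delta>} - {i}" "card D = d"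
  shows "\<exists>\<phi>. (\<forall>h\<in>D. linear_map class_ring (module_vec TYPE('a) \<alpha>) (module_vec TYPE('a) \<beta>) (\<phi> h)) \<and>
    (\<forall>c\<in>C\<^sub>0. \<forall>c'\<in>C\<^sub>0. (\<forall>h\<in>D. \<phi> h (symbol \<alpha> c h) = \<phi> h (symbol \<alpha> c' h)) \<longrightarrow>
      symbol \<alpha> c i = symbol \<alpha> c' i)"
proof -
  have "\<forall>i<L + \<Delta>. \<forall>D. D \<subseteq> {..<L + \<Delta>} - {i} \<and> card D = d \<longrightarrow>
    (\<exists>\<phi>. (\<forall>h\<in>D. linear_map class_ring (module_vec TYPE('a) \<alpha>) (module_vec TYPE('a) \<beta>) (\<phi> h)) \<and>
      (\<forall>c\<in>C\<^sub>0. \<forall>c'\<in>C\<^sub>0. (\<forall>h\<in>D. \<phi> h (symbol \<alpha> c h) = \<phi> h (symbol \<alpha> c' h)) \<longrightarrow>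
        symbol \<alpha> c i = symbol \<alpha> c' i))"
    using regenerating\<^sub>0 unfolding regenerating_code_def by (elim conjE)
  with assms show ?thesis by simp
qed

text \<open>Such a codeword agrees with the zero codeword on \<open>r\<close> symbols, and these
  determine it. The bound \<open>N\<close> lets the zeros be sought among all nodes or among the
  first \<open>L\<close> only.\<close>

lemma zero_if_many_zero_symbols:
  assumes v: "v \<in> carrier_vec (r * \<alpha>)" and N: "N \<le> L + \<Delta>"
    and card: "r \<le> card {i. i < N \<and> symbol \<alpha> (G\<^sub>0\<^sup>T *\<^sub>v v) i = 0\<^sub>v \<alpha>}"
  shows "v = 0\<^sub>v (r * \<alpha>)"
proof -
  obtain S where S: "S \<subseteq> {i. i < N \<and> symbol \<alpha> (G\<^sub>0\<^sup>T *\<^sub>v v) i = 0\<^sub>v \<alpha>}" "card S = r"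
    using obtain_subset_with_card_n[OF card] by blast
  have zero: "G\<^sub>0\<^sup>T *\<^sub>v 0\<^sub>v (r * \<alpha>) = 0\<^sub>v ((L + \<Delta>) * \<alpha>)"
    using G\<^sub>0 by (intro eq_vecI) auto
  have "G\<^sub>0\<^sup>T *\<^sub>v v = G\<^sub>0\<^sup>T *\<^sub>v 0\<^sub>v (r * \<alpha>)"
  proof (rule determined\<^sub>0[OF _ S(2) word\<^sub>0[OF v] word\<^sub>0])
    show "S \<subseteq> {..<L + \<Delta>}" using S(1) N by auto
    show "symbol \<alpha> (G\<^sub>0\<^sup>T *\<^sub>v v) i = symbol \<alpha> (G\<^sub>0\<^sup>T *\<^sub>v 0\<^sub>v (r * \<alpha>)) i" if "i \<in> S" for i
    proof -
      have "i < L + \<Delta>" "symbol \<alpha> (G\<^sub>0\<^sup>T *\<^sub>v v) i = 0\<^sub>v \<alpha>" using that S(1) N by auto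
      then show ?thesis unfolding zero by simp
    qed
  qed simp
  then show ?thesis using inj\<^sub>0[OF v] zero by simp
qed

text \<open>At most \<open>r - 1\<close> symbols vanish, which leaves at least
  \<open>L + \<Delta> - (r - 1) = \<delta> + \<Delta>\<close> nonzero ones.\<close>

lemma weight\<^sub>0:
  assumes v: "v \<in> carrier_vec (r * \<alpha>)" "v \<noteq> 0\<^sub>v (r * \<alpha>)"
  shows "\<delta> + \<Delta> \<le> weight \<alpha> (L + \<Delta>) (G\<^sub>0\<^sup>T *\<^sub>v v)"
  using zero_if_many_zero_symbols[OF v(1) le_refl] v(2) L \<delta>
  unfolding weight_eq_diff_zeros by linarith

text \<open>The local symbols are the first \<open>L\<close> symbols of a codeword of
  \<open>C\<^sub>0\<close>; at most \<open>r - 1\<close> of them vanish, and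
  \<open>L - (r - 1) = \<delta>\<close>.\<close>

lemma weight\<^sub>L:
  assumes v: "v \<in> carrier_vec (r * \<alpha>)" "v \<noteq> 0\<^sub>v (r * \<alpha>)"
  shows "\<delta> \<le> weight \<alpha> L (G\<^sub>L\<^sup>T *\<^sub>v v)"
proof -
  have "{i. i < L \<and> symbol \<alpha> (G\<^sub>L\<^sup>T *\<^sub>v v) i = 0\<^sub>v \<alpha>} = {i. i < L \<and> symbol \<alpha> (G\<^sub>0\<^sup>T *\<^sub>v v) i = 0\<^sub>v \<alpha>}"
    using symbol\<^sub>0_local[OF v(1)] by auto
  then have "\<not> r \<le> card {i. i < L \<and> symbol \<alpha> (G\<^sub>L\<^sup>T *\<^sub>v v) i = 0\<^sub>v \<alpha>}"
    using zero_if_many_zero_symbols[OF v(1), of L] v(2) by auto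
  then show ?thesis
    using L \<delta> unfolding weight_eq_diff_zeros by linarith
qed

text \<open>The zero word has weight 0, below the bound \<open>\<delta>\<close> for nonzero
  messages.\<close>

lemma inj\<^sub>L:
  assumes "v \<in> carrier_vec (r * \<alpha>)" "G\<^sub>L\<^sup>T *\<^sub>v v = 0\<^sub>v (L * \<alpha>)"
  shows "v = 0\<^sub>v (r * \<alpha>)"
proof (rule ccontr)
  assume "v \<noteq> 0\<^sub>v (r * \<alpha>)"
  then have "\<delta> \<le> weight \<alpha> L (0\<^sub>v (L * \<alpha>) :: 'a vec)" using weight\<^sub>L[OF assms(1)] assms(2) by simp
  moreover have "weight \<alpha> L (0\<^sub>v (L * \<alpha>) :: 'a vec) = 0" by (simp add: weight_def cong: conj_cong)
  ultimately show False using \<delta> by simp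
qed

lemma weight\<^sub>0_eq:
  assumes "v \<in> carrier_vec (r * \<alpha>)"
  shows "weight \<alpha> (L + \<Delta>) (G\<^sub>0\<^sup>T *\<^sub>v v) =
    weight \<alpha> L (G\<^sub>L\<^sup>T *\<^sub>v v) + card {s. s < \<Delta> \<and> symbol \<alpha> (Q\<^sup>T *\<^sub>v v) s \<noteq> 0\<^sub>v \<alpha>}"
  unfolding weight_def card_less_add
  using symbol\<^sub>0_local[OF assms] symbol\<^sub>0_global[OF assms] by (simp cong: conj_cong)

lemma thick_columns\<^sub>0:
  assumes "i < L + \<Delta>" "w \<in> carrier_vec \<alpha>"
    and "\<And>v. v \<in> carrier_vec (r * \<alpha>) \<Longrightarrow> symbol \<alpha> (G\<^sub>0\<^sup>T *\<^sub>v v) i \<bullet> w = 0"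
  shows "w = 0\<^sub>v \<alpha>"
  using vector_codeD[OF code\<^sub>0 gen\<^sub>0 assms(1,2)] assms(3) C\<^sub>0_conv_image by blast

text \<open>\<open>r - 1\<close> symbols impose \<open>(r - 1)\<alpha>\<close> linear conditions on \<open>r\<alpha>\<close> coefficients.\<close>

lemma light_word:
  obtains v where "v \<in> carrier_vec (r * \<alpha>)" "v \<noteq> 0\<^sub>v (r * \<alpha>)"
    "weight \<alpha> (L + \<Delta>) (G\<^sub>0\<^sup>T *\<^sub>v v) \<le> \<delta> + \<Delta>"
proof -
  let ?S = "{0..<0 + (r - 1)}"
  define R where "R = restrict_mat \<alpha> ?S G\<^sub>0"
  have S: "?S \<subseteq> {..<L + \<Delta>}" using r_le_L by auto
  have R: "R \<in> carrier_mat (r * \<alpha>) ((r - 1) * \<alpha>)" using G\<^sub>0 by (simp add: R_def restrict_mat_def)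
  have "(r - 1) * \<alpha> < r * \<alpha>" using r \<alpha>_pos by simp
  moreover have "R\<^sup>T \<in> carrier_mat ((r - 1) * \<alpha>) (r * \<alpha>)" using R by simp
  ultimately obtain v where v: "v \<in> carrier_vec (r * \<alpha>)" "v \<noteq> 0\<^sub>v (r * \<alpha>)"
    "R\<^sup>T *\<^sub>v v = 0\<^sub>v ((r - 1) * \<alpha>)"
    using wide_matrix_kernel by blast
  \<comment> \<open>The first \<open>r - 1\<close> symbols vanish as a single coarse symbol, hence
    one by one.\<close>
  have "symbol ((r - 1) * \<alpha>) (G\<^sub>0\<^sup>T *\<^sub>v v) 0 = 0\<^sub>v ((r - 1) * \<alpha>)"
    using restrict_word_transpose_mult[OF G\<^sub>0 S v(1)] v(3) restrict_word_block[of \<alpha> 0 "r - 1" "G\<^sub>0\<^sup>T *\<^sub>v v"]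
    unfolding R_def by simp
  then have "symbol \<alpha> (G\<^sub>0\<^sup>T *\<^sub>v v) i = 0\<^sub>v \<alpha>" if "i < r - 1" for i
    using symbol_symbol[OF that, of \<alpha> "G\<^sub>0\<^sup>T *\<^sub>v v" 0] that by simp
  then have "{..<r - 1} \<subseteq> {i. i < L + \<Delta> \<and> symbol \<alpha> (G\<^sub>0\<^sup>T *\<^sub>v v) i = 0\<^sub>v \<alpha>}"
    using r_le_L by auto
  then have "r - 1 \<le> card {i. i < L + \<Delta> \<and> symbol \<alpha> (G\<^sub>0\<^sup>T *\<^sub>v v) i = 0\<^sub>v \<alpha>}"
    using card_mono[of "{i. i < L + \<Delta> \<and> symbol \<alpha> (G\<^sub>0\<^sup>T *\<^sub>v v) i = 0\<^sub>v \<alpha>}" "{..<r - 1}"] by simp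
  then have "weight \<alpha> (L + \<Delta>) (G\<^sub>0\<^sup>T *\<^sub>v v) \<le> \<delta> + \<Delta>"
    using L r unfolding weight_eq_diff_zeros by linarith
  then show thesis using that v by blast
qed

section \<open>The local code\<close>

definition local_code :: "'a vec set" where
  "local_code = vec_space.row_space (L * \<alpha>) G\<^sub>L"

lemma local_code_conv_image: "local_code = (\<lambda>v. G\<^sub>L\<^sup>T *\<^sub>v v) ` carrier_vec (r * \<alpha>)"
  using row_space_conv_image[OF G\<^sub>L] by (simp add: local_code_def)

lemma scalar_dim_local_code: "scalar_dim (L * \<alpha>) local_code = r * \<alpha>"
  unfolding local_code_def scalar_dim_row_space_iff[OF G\<^sub>L] using inj\<^sub>L by blast

lemma generator_local_code: "generator_matrix \<alpha> L local_code G\<^sub>L"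
  using G\<^sub>L scalar_dim_local_code by (simp add: generator_matrix_def local_code_def)

lemma vector_code_local_code: "vector_code \<alpha> L local_code"
proof (rule vector_codeI)
  show "VectorSpace.subspace class_ring local_code (module_vec TYPE('a) (L * \<alpha>))"
    unfolding local_code_def by (rule subspace_row_space[OF G\<^sub>L])
  fix i and w :: "'a vec"
  assume iw: "i < L" "w \<in> carrier_vec \<alpha>" and "\<And>c. c \<in> local_code \<Longrightarrow> symbol \<alpha> c i \<bullet> w = 0"
  then have "symbol \<alpha> (G\<^sub>0\<^sup>T *\<^sub>v v) i \<bullet> w = 0" if "v \<in> carrier_vec (r * \<alpha>)" for v
    using that symbol\<^sub>0_local[OF that iw(1)] local_code_conv_image by auto
  then show "w = 0\<^sub>v \<alpha>" using thick_columns\<^sub>0[of i w] iw by simp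
qed (rule \<alpha>_pos)

text \<open>Encoding the same message with \<open>G\<^sub>0\<close> extends the word by the symbols
  from \<open>Q\<close>, so properties of \<open>C\<^sub>0\<close> pass to its first
  \<open>L\<close> nodes.\<close>

lemma local_code_extend:
  assumes "c \<in> local_code"
  obtains c' where "c' \<in> C\<^sub>0" "\<And>i. i < L \<Longrightarrow> symbol \<alpha> c' i = symbol \<alpha> c i"
  using assms symbol\<^sub>0_local word\<^sub>0 unfolding local_code_conv_image by blast

lemma local_code_carrier: "c \<in> local_code \<Longrightarrow> c \<in> carrier_vec (L * \<alpha>)"
  using G\<^sub>L unfolding local_code_conv_image by (auto intro!: carrier_vecI)

text \<open>A set of local nodes is also a set of nodes of \<open>C\<^sub>0\<close>, so
  reconstruction and repair are inherited by extending words. The inequality \<open>d < L\<close>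
  leaves \<open>d\<close> helpers beside a failed local node, and \<open>inj\<^sub>L\<close> keeps
  the dimension at \<open>r * \<alpha>\<close>.\<close>

lemma msr_code_local_code: "msr_code L r d \<alpha> \<beta> local_code"
  unfolding msr_code_def regenerating_code_def
proof (intro conjI allI impI ballI)
  fix S c c' assume S: "S \<subseteq> {..<L} \<and> card S = r" and c: "c \<in> local_code" "c' \<in> local_code"
    and eq: "\<forall>i\<in>S. symbol \<alpha> c i = symbol \<alpha> c' i"
  obtain e where e: "e \<in> C\<^sub>0" "\<And>i. i < L \<Longrightarrow> symbol \<alpha> e i = symbol \<alpha> c i"
    using local_code_extend[OF c(1)] by blast
  obtain e' where e': "e' \<in> C\<^sub>0" "\<And>i. i < L \<Longrightarrow> symbol \<alpha> e' i = symbol \<alpha> c' i"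
    using local_code_extend[OF c(2)] by blast
  have "e = e'"
  proof (rule determined\<^sub>0[OF _ _ e(1) e'(1)])
    show "S \<subseteq> {..<L + \<Delta>}" "card S = r" using S by auto
    show "symbol \<alpha> e i = symbol \<alpha> e' i" if "i \<in> S" for i
      using that S eq e(2) e'(2) by auto
  qed
  then show "c = c'"
    using e(2) e'(2) by (intro eq_vec_symbolI[OF local_code_carrier[OF c(1)] local_code_carrier[OF c(2)]]) simp
next
  fix i D assume i: "i < L" and D: "D \<subseteq> {..<L} - {i} \<and> card D = d"
  then have "i < L + \<Delta>" "D \<subseteq> {..<L + \<Delta>} - {i}" "card D = d" by auto
  from repair\<^sub>0[OF this] obtain \<phi> where
    lin: "\<forall>h\<in>D. linear_map class_ring (module_vec TYPE('a) \<alpha>) (module_vec TYPE('a) \<beta>) (\<phi> h)" and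
    rep: "\<forall>c\<in>C\<^sub>0. \<forall>c'\<in>C\<^sub>0. (\<forall>h\<in>D. \<phi> h (symbol \<alpha> c h) = \<phi> h (symbol \<alpha> c' h)) \<longrightarrow>
      symbol \<alpha> c i = symbol \<alpha> c' i"
    by (elim exE conjE)
  show "\<exists>\<phi>. (\<forall>h\<in>D. linear_map class_ring (module_vec TYPE('a) \<alpha>) (module_vec TYPE('a) \<beta>) (\<phi> h)) \<and>
    (\<forall>c\<in>local_code. \<forall>c'\<in>local_code. (\<forall>h\<in>D. \<phi> h (symbol \<alpha> c h) = \<phi> h (symbol \<alpha> c' h)) \<longrightarrow>
      symbol \<alpha> c i = symbol \<alpha> c' i)"
  \<comment> \<open>The repair maps of \<open>C\<^sub>0\<close> serve unchanged, since all helpers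
    in \<open>D\<close> are local.\<close>
  proof (intro exI[of _ \<phi>] conjI ballI impI)
    fix c c' assume c: "c \<in> local_code" "c' \<in> local_code"
      and eq: "\<forall>h\<in>D. \<phi> h (symbol \<alpha> c h) = \<phi> h (symbol \<alpha> c' h)"
    obtain e where e: "e \<in> C\<^sub>0" "\<And>i. i < L \<Longrightarrow> symbol \<alpha> e i = symbol \<alpha> c i"
      using local_code_extend[OF c(1)] by blast
    obtain e' where e': "e' \<in> C\<^sub>0" "\<And>i. i < L \<Longrightarrow> symbol \<alpha> e' i = symbol \<alpha> c' i"
      using local_code_extend[OF c(2)] by blast
    have "\<phi> h (symbol \<alpha> e h) = \<phi> h (symbol \<alpha> e' h)" if "h \<in> D" for h
    proof -
      have "h < L" using that D by auto
      then show ?thesis using e(2) e'(2) eq that by simp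
    qed
    then have "symbol \<alpha> e i = symbol \<alpha> e' i" using rep e(1) e'(1) by blast
    then show "symbol \<alpha> c i = symbol \<alpha> c' i" using e(2) e'(2) i by simp
  qed (use lin in blast)
qed (use r_le_d d_less vector_code_local_code scalar_dim_local_code \<alpha>_eq in simp_all)

lemma d_min_local_code: "\<delta> \<le> d_min \<alpha> L local_code"
proof -
  \<comment> \<open>Only the existence of a nonzero message matters here; it rules out the zero
    code.\<close>
  obtain v :: "'a vec" where v: "v \<in> carrier_vec (r * \<alpha>)" "v \<noteq> 0\<^sub>v (r * \<alpha>)"
    using light_word by blast
  show ?thesis
  proof (rule d_min_geI)
    show "G\<^sub>L\<^sup>T *\<^sub>v v \<in> local_code" using v(1) local_code_conv_image by blast
    show "G\<^sub>L\<^sup>T *\<^sub>v v \<noteq> 0\<^sub>v (L * \<alpha>)" using inj\<^sub>L v by blast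
    fix c assume "c \<in> local_code" and c0: "c \<noteq> 0\<^sub>v (L * \<alpha>)"
    then obtain u where u: "u \<in> carrier_vec (r * \<alpha>)" "c = G\<^sub>L\<^sup>T *\<^sub>v u"
      using local_code_conv_image by blast
    moreover have "G\<^sub>L\<^sup>T *\<^sub>v 0\<^sub>v (r * \<alpha>) = 0\<^sub>v (L * \<alpha>)" using G\<^sub>L by (intro eq_vecI) auto
    ultimately show "\<delta> \<le> weight \<alpha> L c" using weight\<^sub>L[OF u(1)] c0 by auto
  qed
qed

end

section \<open>The code built from m copies\<close>

locale msr_local_construction = msr_code_splitting +
  fixes m :: nat
  assumes m: "1 \<le> m" and \<Delta>_le: "\<Delta> \<le> \<delta>"
begin

abbreviation "n \<equiv> m * L + \<Delta>"

abbreviation "G \<equiv> local_generator m G\<^sub>L Q"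

definition code :: "'a vec set" where
  "code = vec_space.row_space (n * \<alpha>) G"

definition local_set :: "nat \<Rightarrow> nat set" where
  "local_set b = {b * L..<b * L + L}"

lemma G_carrier: "G \<in> carrier_mat (m * (r * \<alpha>)) (n * \<alpha>)"
  using local_generator_carrier[OF G\<^sub>L Q] by (simp add: add_mult_distrib mult.assoc)

lemma code_conv_image: "code = (\<lambda>v. G\<^sup>T *\<^sub>v v) ` carrier_vec (m * (r * \<alpha>))"
  using row_space_conv_image[OF G_carrier] by (simp add: code_def)

lemma transpose_G_zero: "G\<^sup>T *\<^sub>v 0\<^sub>v (m * (r * \<alpha>)) = 0\<^sub>v (n * \<alpha>)"
  using G_carrier by (intro eq_vecI) auto

lemma restrict_word_local_set:
  assumes "v \<in> carrier_vec (m * (r * \<alpha>))" "b < m"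
  shows "restrict_word \<alpha> (local_set b) (G\<^sup>T *\<^sub>v v) = G\<^sub>L\<^sup>T *\<^sub>v symbol (r * \<alpha>) v b"
  unfolding local_set_def restrict_word_block by (rule local_generator_local_part[OF G\<^sub>L Q assms])

lemma symbol_local_part:
  assumes "v \<in> carrier_vec (m * (r * \<alpha>))" "b < m" "s < L"
  shows "symbol \<alpha> (G\<^sup>T *\<^sub>v v) (b * L + s) = symbol \<alpha> (G\<^sub>L\<^sup>T *\<^sub>v symbol (r * \<alpha>) v b) s"
  using local_generator_local_part[OF G\<^sub>L Q assms(1,2)] symbol_symbol[OF assms(3), of \<alpha> _ b] by metis

text \<open>Message block \<open>b\<close> can be chosen freely, as \<open>embed_block\<close>
  shows, so local group \<open>b\<close> carries every word of the local code.\<close>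

lemma puncture_local_set:
  assumes b: "b < m"
  shows "puncture \<alpha> (local_set b) code = local_code"
proof -
  have "(\<lambda>v. symbol (r * \<alpha>) v b) ` carrier_vec (m * (r * \<alpha>)) = (carrier_vec (r * \<alpha>) :: 'a vec set)"
  proof
    show "carrier_vec (r * \<alpha>) \<subseteq> (\<lambda>v :: 'a vec. symbol (r * \<alpha>) v b) ` carrier_vec (m * (r * \<alpha>))"
    proof
      fix x :: "'a vec" assume x: "x \<in> carrier_vec (r * \<alpha>)"
      have "x = symbol (r * \<alpha>) (embed_block m (r * \<alpha>) b x) b"
        using symbol_embed_block[OF x b, of b] by simp
      then show "x \<in> (\<lambda>v. symbol (r * \<alpha>) v b) ` carrier_vec (m * (r * \<alpha>))"
        by (rule image_eqI) simp
    qed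
  qed auto
  then have "local_code = (\<lambda>v. G\<^sub>L\<^sup>T *\<^sub>v v) ` (\<lambda>v. symbol (r * \<alpha>) v b) ` carrier_vec (m * (r * \<alpha>))"
    by (simp add: local_code_conv_image)
  also have "\<dots> = puncture \<alpha> (local_set b) code"
    unfolding puncture_def code_conv_image image_image
    using restrict_word_local_set[OF _ b] by (intro image_cong) simp_all
  finally show ?thesis ..
qed

text \<open>Each message block is recovered from its own local group by \<open>inj\<^sub>L\<close>.
  This gives the dimension of the code as well as full rank on the union of the local sets.\<close>

lemma inj_local_part:
  assumes v: "v \<in> carrier_vec (m * (r * \<alpha>))"
    and zero: "\<And>i. i < m * L \<Longrightarrow> symbol \<alpha> (G\<^sup>T *\<^sub>v v) i = 0\<^sub>v \<alpha>"
  shows "v = 0\<^sub>v (m * (r * \<alpha>))"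
proof (rule eq_vec_symbolI[OF v])
  fix b assume b: "b < m"
  have "G\<^sub>L\<^sup>T *\<^sub>v symbol (r * \<alpha>) v b = 0\<^sub>v (L * \<alpha>)"
  proof (rule eq_vec_symbolI)
    fix s assume s: "s < L"
    show "symbol \<alpha> (G\<^sub>L\<^sup>T *\<^sub>v symbol (r * \<alpha>) v b) s = symbol \<alpha> (0\<^sub>v (L * \<alpha>)) s"
      using symbol_local_part[OF v b s] zero[OF block_index_less[OF b s]] s by simp
  qed (use G\<^sub>L in \<open>auto intro: carrier_vecI\<close>)
  then show "symbol (r * \<alpha>) v b = symbol (r * \<alpha>) (0\<^sub>v (m * (r * \<alpha>))) b"
    using inj\<^sub>L[OF symbol_carrier] b by simp
qed simp

lemma inj_word:
  assumes "v \<in> carrier_vec (m * (r * \<alpha>))" "G\<^sup>T *\<^sub>v v = 0\<^sub>v (n * \<alpha>)"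
  shows "v = 0\<^sub>v (m * (r * \<alpha>))"
proof (rule inj_local_part[OF assms(1)])
  show "symbol \<alpha> (G\<^sup>T *\<^sub>v v) i = 0\<^sub>v \<alpha>" if "i < m * L" for i
  proof -
    have "i < n" using that by simp
    then show ?thesis unfolding assms(2) by (rule symbol_zero)
  qed
qed

lemma scalar_dim_code: "scalar_dim (n * \<alpha>) code = m * (r * \<alpha>)"
  unfolding code_def scalar_dim_row_space_iff[OF G_carrier] using inj_word by blast

lemma generator_code: "generator_matrix \<alpha> n code G"
  unfolding generator_matrix_def scalar_dim_code using G_carrier by (simp add: code_def)

lemma symbol_word_supported_on_block:
  assumes v: "v \<in> carrier_vec (m * (r * \<alpha>))" and b: "b < m" and s: "s < \<Delta>"
    and zero: "\<And>b'. b' < m \<Longrightarrow> b' \<noteq> b \<Longrightarrow> symbol (r * \<alpha>) v b' = 0\<^sub>v (r * \<alpha>)"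
  shows "symbol \<alpha> (G\<^sup>T *\<^sub>v v) (m * L + s) = symbol \<alpha> (Q\<^sup>T *\<^sub>v symbol (r * \<alpha>) v b) s"
  by (rule local_generator_global_part[OF G\<^sub>L Q v b s zero])

text \<open>Single-block messages suffice as tests: for them the i-th symbol is a symbol of a
  codeword of \<open>C\<^sub>0\<close>, namely symbol \<open>s\<close> at position \<open>s\<close>
  of a local group and symbol \<open>L + s\<close> at the s-th global node. The standing assumption
  on \<open>C\<^sub>0\<close> then applies.\<close>

lemma vector_code_code: "vector_code \<alpha> n code"
proof (rule vector_codeI)
  show "VectorSpace.subspace class_ring code (module_vec TYPE('a) (n * \<alpha>))"
    unfolding code_def by (rule subspace_row_space[OF G_carrier])
  fix i and w :: "'a vec"
  assume i: "i < n" and w: "w \<in> carrier_vec \<alpha>" and orth: "\<And>c. c \<in> code \<Longrightarrow> symbol \<alpha> c i \<bullet> w = 0"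
  have embed: "symbol \<alpha> (G\<^sup>T *\<^sub>v embed_block m (r * \<alpha>) b x) i \<bullet> w = 0" for b and x :: "'a vec"
    by (rule orth) (simp add: code_conv_image)
  show "w = 0\<^sub>v \<alpha>"
  proof (cases "i < m * L")
    case True
    define b s where "b = i div L" and "s = i mod L"
    have "0 < L" using r r_le_L by simp
    then have b: "b < m" and s: "s < L" and i_eq: "i = b * L + s"
      using True by (simp_all add: b_def s_def less_mult_imp_div_less)
    show ?thesis
    proof (rule thick_columns\<^sub>0[OF _ w])
      show "s < L + \<Delta>" using s by simp
      show "symbol \<alpha> (G\<^sub>0\<^sup>T *\<^sub>v x) s \<bullet> w = 0" if x: "x \<in> carrier_vec (r * \<alpha>)" for x
        using embed[of b x] symbol_local_part[OF embed_block_carrier b s, of b x]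
          symbol_embed_block[OF x b, of b] symbol\<^sub>0_local[OF x s] i_eq by simp
    qed
  next
    case False
    define s where "s = i - m * L"
    have s: "s < \<Delta>" and i_eq: "i = m * L + s" using False i by (simp_all add: s_def)
    \<comment> \<open>Every message block reaches the global symbols; block 0 is chosen and exists
      because \<open>m\<close> is positive.\<close>
    have b: "0 < m" using m by simp
    show ?thesis
    proof (rule thick_columns\<^sub>0[OF _ w])
      show "L + s < L + \<Delta>" using s by simp
      fix x :: "'a vec" assume x: "x \<in> carrier_vec (r * \<alpha>)"
      have "symbol \<alpha> (G\<^sup>T *\<^sub>v embed_block m (r * \<alpha>) 0 x) (m * L + s) = symbol \<alpha> (Q\<^sup>T *\<^sub>v x) s"
        using symbol_word_supported_on_block[OF embed_block_carrier b s, of 0 x]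
          symbol_embed_block[OF x] b by simp
      then show "symbol \<alpha> (G\<^sub>0\<^sup>T *\<^sub>v x) (L + s) \<bullet> w = 0"
        using embed[of 0 x] symbol\<^sub>0_global[OF x s] i_eq by simp
    qed
  qed
qed (rule \<alpha>_pos)

text \<open>The interval keeps the unreduced form \<open>0 * (m * L)\<close> so that
  \<open>restrict_word_block\<close> matches it with \<open>b = 0\<close> and
  \<open>k = m * L\<close>.\<close>

lemma Union_local_set: "(\<Union>b<m. local_set b) = {0 * (m * L)..<0 * (m * L) + m * L}"
proof
  show "{0 * (m * L)..<0 * (m * L) + m * L} \<subseteq> (\<Union>b<m. local_set b)"
  proof
    fix i assume i: "i \<in> {0 * (m * L)..<0 * (m * L) + m * L}"
    have "0 < L" using r r_le_L by simp
    then have "i \<in> local_set (i div L)"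
      using div_times_less_eq_dividend[of i L] dividend_less_div_times[of L i]
      by (simp add: local_set_def add.commute)
    moreover have "i div L < m" using i by (simp add: less_mult_imp_div_less)
    ultimately show "i \<in> (\<Union>b<m. local_set b)" by blast
  qed
  show "(\<Union>b<m. local_set b) \<subseteq> {0 * (m * L)..<0 * (m * L) + m * L}"
  proof
    fix i assume "i \<in> (\<Union>b<m. local_set b)"
    then obtain b where b: "b < m" "b * L \<le> i" "i < b * L + L" by (auto simp: local_set_def)
    then have "b * L + (i - b * L) < m * L" by (intro block_index_less) auto
    then show "i \<in> {0 * (m * L)..<0 * (m * L) + m * L}" using b by simp
  qed
qed

lemma disjoint_local_set: "disjoint_family_on local_set {..<m}"
proof -
  have "b * L + L \<le> b' * L" if "b < b'" for b b'
    using mult_le_mono1[of "Suc b" b' L] that by simp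
  then have less: "local_set b \<inter> local_set b' = {}" if "b < b'" for b b'
    using that unfolding local_set_def by fastforce
  have "local_set b \<inter> local_set b' = {}" if "b \<noteq> b'" for b b'
    using less[of b b'] less[of b' b] that by (cases "b < b'") auto
  then show ?thesis by (simp add: disjoint_family_on_def)
qed

text \<open>The generator matrix \<open>H\<close> is arbitrary. A left kernel vector of its
  restriction encodes to a codeword vanishing on all local groups; that codeword is zero by
  \<open>inj_local_part\<close>, and since the rows of \<open>H\<close> form a basis, so is the
  vector.\<close>

lemma full_rank_local_sets: "full_rank_on \<alpha> n code (\<Union>b<m. local_set b)"
  unfolding full_rank_on_def
proof (intro allI impI)
  fix H assume H_gen: "generator_matrix \<alpha> n code H"
  define U where "U = (\<Union>b<m. local_set b)"
  define K where "K = scalar_dim (n * \<alpha>) code"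
  have H: "H \<in> carrier_mat K (n * \<alpha>)" and row_H: "vec_space.row_space (n * \<alpha>) H = code"
    using H_gen by (simp_all add: generator_matrix_def K_def)
  have U: "U \<subseteq> {..<n}" unfolding U_def Union_local_set by auto
  have A: "restrict_mat \<alpha> U H \<in> carrier_mat K (card U * \<alpha>)"
    using H by (simp add: restrict_mat_def)
  have "v = 0\<^sub>v K" if v: "v \<in> carrier_vec K" and zero: "(restrict_mat \<alpha> U H)\<^sup>T *\<^sub>v v = 0\<^sub>v (card U * \<alpha>)" for v
  proof -
    have "H\<^sup>T *\<^sub>v v \<in> code" using v row_space_conv_image[OF H] row_H by blast
    \<comment> \<open>The codeword is rewritten with \<open>G\<close>, whose block structure is
      known.\<close>
    then obtain u where u: "u \<in> carrier_vec (m * (r * \<alpha>))" "H\<^sup>T *\<^sub>v v = G\<^sup>T *\<^sub>v u"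
      unfolding code_conv_image by blast
    have "restrict_word \<alpha> U (G\<^sup>T *\<^sub>v u) = 0\<^sub>v (card U * \<alpha>)"
      using restrict_word_transpose_mult[OF H U v] zero u(2) by simp
    then have first: "symbol (m * L * \<alpha>) (G\<^sup>T *\<^sub>v u) 0 = 0\<^sub>v (m * L * \<alpha>)"
      unfolding U_def Union_local_set restrict_word_block by simp
    have "symbol \<alpha> (G\<^sup>T *\<^sub>v u) i = 0\<^sub>v \<alpha>" if "i < m * L" for i
    proof -
      have "symbol \<alpha> (G\<^sup>T *\<^sub>v u) i = symbol \<alpha> (symbol (m * L * \<alpha>) (G\<^sup>T *\<^sub>v u) 0) i"
        using symbol_symbol[OF that, of \<alpha> "G\<^sup>T *\<^sub>v u" 0] by simp
      also have "\<dots> = 0\<^sub>v \<alpha>" unfolding first using that by (rule symbol_zero)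
      finally show ?thesis .
    qed
    then have "u = 0\<^sub>v (m * (r * \<alpha>))" by (rule inj_local_part[OF u(1)])
    then have "H\<^sup>T *\<^sub>v v = 0\<^sub>v (n * \<alpha>)" using u(2) transpose_G_zero by simp
    moreover have "scalar_dim (n * \<alpha>) (vec_space.row_space (n * \<alpha>) H) = K"
      unfolding row_H K_def ..
    ultimately show ?thesis
      using scalar_dim_row_space_iff[OF H] v by blast
  qed
  then have "vec_space.rank K (restrict_mat \<alpha> U H) = K"
    by (rule vec_space.rank_eq_rows_if_left_kernel[OF A])
  then show "vec_space.rank (dim_row H) (restrict_mat \<alpha> (\<Union>b<m. local_set b) H) = scalar_dim (n * \<alpha>) code"
    using H by (simp add: U_def K_def)
qed

lemma local_code_at_local_set:
  assumes b: "b < m"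
  shows "local_code_at \<alpha> n r \<delta> code (local_set b)"
proof -
  have "local_set b \<subseteq> (\<Union>b<m. local_set b)" using b by blast
  then have "local_set b \<subseteq> {..<n}" unfolding Union_local_set by auto
  moreover have card: "card (local_set b) = L" by (simp add: local_set_def)
  moreover have "L \<le> r + \<delta> - 1" by (simp add: L)
  moreover have "\<delta> \<le> d_min \<alpha> (card (local_set b)) (puncture \<alpha> (local_set b) code)"
    unfolding card puncture_local_set[OF b] by (rule d_min_local_code)
  ultimately show ?thesis by (simp add: local_code_at_def)
qed

lemma information_locality_code: "information_locality \<alpha> n r \<delta> code"
  unfolding information_locality_def
  using vector_code_code full_rank_local_sets local_code_at_local_set
  by (intro conjI exI[of _ "local_set ` {..<m}"]) auto

lemma msr_local_codes_code: "msr_local_codes \<alpha> n r \<delta> d m local_set code"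
  unfolding msr_local_codes_def
proof (intro conjI allI impI exI)
  fix b assume b: "b < m"
  show "local_code_at \<alpha> n r \<delta> code (local_set b)" by (rule local_code_at_local_set[OF b])
  show "card (local_set b) = r + \<delta> - 1"
    unfolding L[symmetric] by (simp add: local_set_def)
  show "msr_code (r + \<delta> - 1) r d \<alpha> \<beta> (puncture \<alpha> (local_set b) code)"
    unfolding puncture_local_set[OF b] L[symmetric] by (rule msr_code_local_code)
qed (rule full_rank_local_sets)

section \<open>Weights and minimum distance\<close>

lemma weight_word:
  assumes "v \<in> carrier_vec (m * (r * \<alpha>))"
  shows "weight \<alpha> n (G\<^sup>T *\<^sub>v v) = (\<Sum>b<m. weight \<alpha> L (G\<^sub>L\<^sup>T *\<^sub>v symbol (r * \<alpha>) v b))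
    + card {s. s < \<Delta> \<and> symbol \<alpha> (G\<^sup>T *\<^sub>v v) (m * L + s) \<noteq> 0\<^sub>v \<alpha>}"
proof -
  have "card {s. s < L \<and> symbol \<alpha> (G\<^sup>T *\<^sub>v v) (b * L + s) \<noteq> 0\<^sub>v \<alpha>} =
      weight \<alpha> L (G\<^sub>L\<^sup>T *\<^sub>v symbol (r * \<alpha>) v b)" if "b < m" for b
    unfolding weight_def using symbol_local_part[OF assms that] by (simp cong: conj_cong)
  then show ?thesis
    unfolding weight_def[of \<alpha> n] card_less_add card_less_mult by simp
qed

text \<open>The other local groups vanish and the global symbols come from block \<open>b\<close>
  alone, so the nonzero symbols are those of one codeword of \<open>C\<^sub>0\<close>, placed at
  other positions.\<close>

lemma weight_word_supported_on_block:
  assumes v: "v \<in> carrier_vec (m * (r * \<alpha>))" and b: "b < m"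
    and zero: "\<And>b'. b' < m \<Longrightarrow> b' \<noteq> b \<Longrightarrow> symbol (r * \<alpha>) v b' = 0\<^sub>v (r * \<alpha>)"
  shows "weight \<alpha> n (G\<^sup>T *\<^sub>v v) = weight \<alpha> (L + \<Delta>) (G\<^sub>0\<^sup>T *\<^sub>v symbol (r * \<alpha>) v b)"
proof -
  have "G\<^sub>L\<^sup>T *\<^sub>v 0\<^sub>v (r * \<alpha>) = 0\<^sub>v (L * \<alpha>)" using G\<^sub>L by (intro eq_vecI) auto
  then have "weight \<alpha> L (G\<^sub>L\<^sup>T *\<^sub>v symbol (r * \<alpha>) v b') = 0" if "b' < m" "b' \<noteq> b" for b'
    using zero[OF that] by (simp add: weight_def cong: conj_cong)
  then have "(\<Sum>b'<m. weight \<alpha> L (G\<^sub>L\<^sup>T *\<^sub>v symbol (r * \<alpha>) v b'))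
      = weight \<alpha> L (G\<^sub>L\<^sup>T *\<^sub>v symbol (r * \<alpha>) v b)"
    using b by (subst sum.remove[of _ b]) auto
  moreover have "{s. s < \<Delta> \<and> symbol \<alpha> (G\<^sup>T *\<^sub>v v) (m * L + s) \<noteq> 0\<^sub>v \<alpha>}
      = {s. s < \<Delta> \<and> symbol \<alpha> (Q\<^sup>T *\<^sub>v symbol (r * \<alpha>) v b) s \<noteq> 0\<^sub>v \<alpha>}"
    using symbol_word_supported_on_block[OF v b _ zero] by auto
  ultimately show ?thesis
    unfolding weight_word[OF v] weight\<^sub>0_eq[OF symbol_carrier] by simp
qed

lemma weight_ge:
  assumes v: "v \<in> carrier_vec (m * (r * \<alpha>))" and nz: "v \<noteq> 0\<^sub>v (m * (r * \<alpha>))"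
  shows "\<delta> + \<Delta> \<le> weight \<alpha> n (G\<^sup>T *\<^sub>v v)"
proof -
  let ?w = "\<lambda>b. weight \<alpha> L (G\<^sub>L\<^sup>T *\<^sub>v symbol (r * \<alpha>) v b)"
  have "\<exists>b<m. symbol (r * \<alpha>) v b \<noteq> 0\<^sub>v (r * \<alpha>)"
  proof (rule ccontr)
    assume "\<not> ?thesis"
    then have "v = 0\<^sub>v (m * (r * \<alpha>))" by (intro eq_vec_symbolI[OF v]) auto
    then show False using nz by contradiction
  qed
  then obtain b where b: "b < m" "symbol (r * \<alpha>) v b \<noteq> 0\<^sub>v (r * \<alpha>)" by blast
  show ?thesis
  proof (cases "\<exists>b'<m. b' \<noteq> b \<and> symbol (r * \<alpha>) v b' \<noteq> 0\<^sub>v (r * \<alpha>)")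
    case True
    then obtain b' where b': "b' < m" "b' \<noteq> b" "symbol (r * \<alpha>) v b' \<noteq> 0\<^sub>v (r * \<alpha>)" by blast
    \<comment> \<open>Two nonzero blocks already give \<open>2 * \<delta>\<close> within the local
      groups, and \<open>\<Delta> \<le> \<delta>\<close> makes this enough.\<close>
    have "\<delta> + \<delta> \<le> ?w b + ?w b'"
      using weight\<^sub>L[OF symbol_carrier b(2)] weight\<^sub>L[OF symbol_carrier b'(3)] by simp
    also have "\<dots> = sum ?w {b, b'}" using b'(2) by simp
    also have "\<dots> \<le> sum ?w {..<m}" using b(1) b'(1) by (intro sum_mono2) auto
    finally show ?thesis using weight_word[OF v] \<Delta>_le by simp
  next
    case False
    then have "weight \<alpha> n (G\<^sup>T *\<^sub>v v) = weight \<alpha> (L + \<Delta>) (G\<^sub>0\<^sup>T *\<^sub>v symbol (r * \<alpha>) v b)"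
      by (intro weight_word_supported_on_block[OF v b(1)]) blast
    then show ?thesis using weight\<^sub>0[OF symbol_carrier b(2)] by simp
  qed
qed

lemma d_min_code: "d_min \<alpha> n code = \<delta> + \<Delta>"
proof -
  obtain x where x: "x \<in> carrier_vec (r * \<alpha>)" "x \<noteq> 0\<^sub>v (r * \<alpha>)"
    "weight \<alpha> (L + \<Delta>) (G\<^sub>0\<^sup>T *\<^sub>v x) \<le> \<delta> + \<Delta>" using light_word by blast
  \<comment> \<open>Placing a light message of \<open>C\<^sub>0\<close> in block 0 keeps its weight,
    so the lower bound is attained.\<close>
  define v where "v = embed_block m (r * \<alpha>) 0 x"
  have v: "v \<in> carrier_vec (m * (r * \<alpha>))" by (simp add: v_def)
  have blocks: "symbol (r * \<alpha>) v b = (if b = 0 then x else 0\<^sub>v (r * \<alpha>))" if "b < m" for b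
    unfolding v_def by (rule symbol_embed_block[OF x(1) that])
  have b: "0 < m" using m by simp
  have "v \<noteq> 0\<^sub>v (m * (r * \<alpha>))" using blocks[OF b] x(2) symbol_zero[OF b, of "r * \<alpha>"] by auto
  show ?thesis
  proof (rule d_min_eqI)
    show "G\<^sup>T *\<^sub>v v \<in> code" using v code_conv_image by blast
    show "G\<^sup>T *\<^sub>v v \<noteq> 0\<^sub>v (n * \<alpha>)" using inj_word[OF v] \<open>v \<noteq> 0\<^sub>v (m * (r * \<alpha>))\<close> by blast
    show "weight \<alpha> n (G\<^sup>T *\<^sub>v v) \<le> \<delta> + \<Delta>"
      using weight_word_supported_on_block[OF v b] blocks b x(3) by simp
    fix c assume "c \<in> code" and c0: "c \<noteq> 0\<^sub>v (n * \<alpha>)"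
    then obtain u where u: "u \<in> carrier_vec (m * (r * \<alpha>))" "c = G\<^sup>T *\<^sub>v u"
      unfolding code_conv_image by blast
    then have "u \<noteq> 0\<^sub>v (m * (r * \<alpha>))" using c0 transpose_G_zero by auto
    then show "\<delta> + \<Delta> \<le> weight \<alpha> n c" using weight_ge[OF u(1)] u(2) by simp
  qed
qed

end

text \<open>\<open>msr_local_codes\<close> asserts only some \<beta> for each local code, so a
  further conjunct fixes the given \<beta> and the generator matrix. The distance formula is stated
  over the reals, where quotients and differences are not truncated.\<close>

theorem mainTheorem8:
  fixes r \<delta> \<Delta> m d \<alpha> \<beta> n\<^sub>L n :: nat
    and C\<^sub>0 C :: "'a::{field,finite} vec set"
    and G\<^sub>L Q\<^sub>\<Delta> G :: "'a mat"
  assumes "1 \<le> r" and "3 \<le> \<delta>" and "1 \<le> m" and "\<Delta> \<le> \<delta>"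
    and n\<^sub>L: "n\<^sub>L = r + \<delta> - 1"
    and "d \<le> r + \<delta> - 2"
    and "msr_code (n\<^sub>L + \<Delta>) r d \<alpha> \<beta> C\<^sub>0"
    and "G\<^sub>L \<in> carrier_mat (r * \<alpha>) (n\<^sub>L * \<alpha>)"
    and "Q\<^sub>\<Delta> \<in> carrier_mat (r * \<alpha>) (\<Delta> * \<alpha>)"
    and "generator_matrix \<alpha> (n\<^sub>L + \<Delta>) C\<^sub>0 (beside G\<^sub>L Q\<^sub>\<Delta>)"
    and n: "n = m * n\<^sub>L + \<Delta>"
    and G: "G = local_generator m G\<^sub>L Q\<^sub>\<Delta>"
    and C: "C = vec_space.row_space (n * \<alpha>) G"
  shows "msr_local_code \<alpha> n r \<delta> C
    \<and> vector_code \<alpha> n C \<and> generator_matrix \<alpha> n C G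
    \<and> (\<exists>S. msr_local_codes \<alpha> n r \<delta> d m S C \<and> disjoint_family_on S {..<m} \<and>
          (\<forall>i<m. msr_code n\<^sub>L r d \<alpha> \<beta> (puncture \<alpha> (S i) C) \<and>
                 generator_matrix \<alpha> n\<^sub>L (puncture \<alpha> (S i) C) G\<^sub>L))
    \<and> scalar_dim (n * \<alpha>) C = m * r * \<alpha>
    \<and> real (d_min \<alpha> n C) =
        real n - real (scalar_dim (n * \<alpha>) C) / real \<alpha> + 1
          - (real (scalar_dim (n * \<alpha>) C) / real (r * \<alpha>) - 1) * (real \<delta> - 1)
    \<and> d_min \<alpha> n C = \<delta> + \<Delta>"
proof -
  interpret msr_local_construction r \<delta> \<Delta> d \<alpha> \<beta> n\<^sub>L C\<^sub>0 G\<^sub>L Q\<^sub>\<Delta> m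
  proof unfold_locales
    \<comment> \<open>Since \<open>r + \<delta> \<ge> 4\<close>, neither natural subtraction is
      truncated and \<open>r + \<delta> - 2 < r + \<delta> - 1\<close>.\<close>
    show "1 \<le> \<delta>" "d < n\<^sub>L" using assms(1,2,6) n\<^sub>L by simp_all
  qed (fact assms)+
  have code: "code = C" by (simp only: code_def C G n)
  have dim: "scalar_dim (n * \<alpha>) C = m * r * \<alpha>"
    using scalar_dim_code unfolding code n by (simp add: mult.assoc)
  have d_min: "d_min \<alpha> n C = \<delta> + \<Delta>"
    using d_min_code unfolding code n .
  have local_codes: "msr_local_codes \<alpha> n r \<delta> d m local_set C"
    using msr_local_codes_code unfolding code n .
  have "msr_local_code \<alpha> n r \<delta> C"
    unfolding msr_local_code_def
    using information_locality_code local_codes unfolding code n by blast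
  moreover have "vector_code \<alpha> n C" using vector_code_code unfolding code n .
  moreover have "generator_matrix \<alpha> n C G" using generator_code unfolding code n G .
  moreover have "msr_code n\<^sub>L r d \<alpha> \<beta> (puncture \<alpha> (local_set i) C) \<and>
      generator_matrix \<alpha> n\<^sub>L (puncture \<alpha> (local_set i) C) G\<^sub>L" if "i < m" for i
    unfolding puncture_local_set[OF that, unfolded code]
    using msr_code_local_code generator_local_code ..
  \<comment> \<open>The right-hand side is \<open>n - m r + 1 - (m - 1)(\<delta> - 1)\<close>, and
    inserting \<open>n = m (r + \<delta> - 1) + \<Delta>\<close> cancels every term with a factor
    \<open>m\<close>.\<close>
  moreover have "real (\<delta> + \<Delta>) = real n - real (m * r * \<alpha>) / real \<alpha> + 1
      - (real (m * r * \<alpha>) / real (r * \<alpha>) - 1) * (real \<delta> - 1)"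
  proof -
    have "real (m * r * \<alpha>) / real \<alpha> = real m * real r" using \<alpha>_pos by simp
    moreover have "real (m * r * \<alpha>) / real (r * \<alpha>) = real m" using \<alpha>_pos assms(1) by simp
    moreover have "real n = real m * (real r + real \<delta> - 1) + real \<Delta>"
      using assms(1) unfolding n n\<^sub>L by (simp add: of_nat_diff)
    ultimately show ?thesis by (simp add: algebra_simps)
  qed
  ultimately show ?thesis
    using dim d_min local_codes disjoint_local_set by auto
qed

end
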